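(* There exist an index $k_0\in\mathbb{N}$ and constants $\bar\tau_0>0$, $C>0$, $C'>0$, with $\bar\tau_0,C,C'$ depending only on $d,s,\gamma,\tau_0,\kappa,\kappa_\nabla,\kappa_{\mathrm{hess}},\rho,R,L$, such that for every $\tau\in(0,\bar\tau_0]$, setting $k_\tau=C\lceil\log(\bar\tau_0/\tau)\rceil$: $\mathrm{dist}(\xi,X_k)\le\tau$ for all $k\ge k_0+k_\tau$, and for all $k\ge k_0+k_\tau+1$, $$\|q_k-q^\star\|_2\le C'\tau,\qquad \inf(\mathcal{P}(\Omega_k))\le\inf(\mathcal{P})+C'\tau^2.$$ In other words, the iterates eventually converge at a linear rate.
   Context: Setting: $\Omega\subseteq\mathbb{R}^d$ nonempty open convex; $\mathcal{M}(\Omega)$ finite signed Radon measures with total variation norm $\|\cdot\|_{\mathcal{M}}$, $\mathcal{M}(\Omega')$ those supported in $\Omega'\subseteq\Omega$; $a_1,\dots,a_m\in\mathcal{C}_0(\Omega)\cap\mathcal{C}^2(\Omega)$ with uniformly bounded first and second derivatives; $(A\mu)_i=\int a_i\,d\mu$, $A^*q=\sum_iq_ia_i$. $f:\mathbb{R}^m\to\mathbb{R}$ convex, bounded below, differentiable with $L$-Lipschitz gradient; $f^*$ its conjugate. $J(\mu)=\|\mu\|_{\mathcal{M}}+f(A\mu)$; $(\mathcal{P}(\Omega'))$: $\inf_{\mu\in\mathcal{M}(\Omega')}J(\mu)$; $(\mathcal{D}(\Omega'))$: $\sup\{-f^*(q):|A^*q(x)|\le1\ \forall x\in\Omega'\}$;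 $(\mathcal{P}),(\mathcal{D})$ for $\Omega'=\Omega$. Standing: all these problems used have solutions and no duality gap. Exchange algorithm: given $\Omega_0\subseteq\Omega$, for $k\ge0$, $\mu_k$ solves $(\mathcal{P}(\Omega_k))$, $q_k$ is the solution of $(\mathcal{D}(\Omega_k))$, $X_k$ is the set of local maximizers $x\in\Omega$ of $|A^*q_k|$ with $|A^*q_k(x)|>1$, $\Omega_{k+1}=\Omega_k\cup X_k$. For $Y,Z\subseteq\mathbb{R}^d$: $\mathrm{dist}(Y,Z)=\sup_{z\in Z}\inf_{y\in Y}\|y-z\|_2$ (equal to $0$ if $Z=\emptyset$); for a point $x$, $\mathrm{dist}(x,\xi)=\min_i\|x-\xi_i\|_2$. Constants: $\kappa=\sup_{\|q\|_2\le1}\|A^*q\|_\infty$, $\kappa_\nabla=\sup_{\|q\|_2\le1}\sup_x\|\nabla(A^*q)(x)\|_2$, $\kappa_{\mathrm{hess}}=\sup_{\|q\|_2\le1}\sup_x\|\nabla^2(A^*q)(x)\|_{\mathrm{op}}$; $\bar q$ the minimizer of $f^*$, $R=\sqrt{2L(f^*(0)-f^*(\bar q))}+\|\bar q\|_2$; $\rho=\sqrt{\sup_{w\in\partial f^*(q^\star)}-L\langle w,q^\star\rangle}$, assumed finite. Source condition: $(\mathcal{P})$ has a unique solution $\mu^\star=\sum_{i=1}^s\alpha_i^\star\delta_{\xi_i}$ (distinct $\xi_i\in\Omega$, $\alpha_i^\star\ne0$), $\xi=\{\xi_1,\dots,\xi_s\}$; $q^\star$ is the solution of $(\mathcal{D})$;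 $|A^*q^\star(x)|=1$ iff $x\in\xi$; and there are $\tau_0>0,\gamma>0$ with: for $x\in\Omega$ with $\mathrm{dist}(x,\xi)\le\tau_0$, $|A^*q^\star(x)|\ge\gamma\tau_0^2/2$ and $\nabla^2|A^*q^\star|(x)\preccurlyeq-\gamma\,\mathrm{Id}$; for $x\in\Omega$ with $\mathrm{dist}(x,\xi)\ge\tau_0$, $|A^*q^\star(x)|\le1-\gamma\tau_0^2/2$. *)

theory Defs
  imports "HOL-Analysis.Analysis"
begin

section \<open>The measurement space R^m, rendered as nat-indexed vectors vanishing from index m on\<close>

definition mvec :: "nat \<Rightarrow> (nat \<Rightarrow> real) set" where
  "mvec m = {q. \<forall>i\<ge>m. q i = 0}"

definition ip :: "nat \<Rightarrow> (nat \<Rightarrow> real) \<Rightarrow> (nat \<Rightarrow> real) \<Rightarrow> real" where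
  "ip m p q = (\<Sum>i<m. p i * q i)"

definition nrm :: "nat \<Rightarrow> (nat \<Rightarrow> real) \<Rightarrow> real" where
  "nrm m q = sqrt (ip m q q)"

definition vsub :: "(nat \<Rightarrow> real) \<Rightarrow> (nat \<Rightarrow> real) \<Rightarrow> (nat \<Rightarrow> real)" where
  "vsub p q = (\<lambda>i. p i - q i)"

definition mconvex :: "nat \<Rightarrow> ((nat \<Rightarrow> real) \<Rightarrow> real) \<Rightarrow> bool" where
  "mconvex m f = (\<forall>x\<in>mvec m. \<forall>y\<in>mvec m. \<forall>t::real. 0 \<le> t \<and> t \<le> 1 \<longrightarrow>
      f (\<lambda>i. t * x i + (1 - t) * y i) \<le> t * f x + (1 - t) * f y)"

definition mbounded_below :: "nat \<Rightarrow> ((nat \<Rightarrow> real) \<Rightarrow> real) \<Rightarrow> bool" where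
  "mbounded_below m f = (\<exists>b. \<forall>y\<in>mvec m. b \<le> f y)"

definition mgrad :: "nat \<Rightarrow> ((nat \<Rightarrow> real) \<Rightarrow> real) \<Rightarrow> ((nat \<Rightarrow> real) \<Rightarrow> (nat \<Rightarrow> real)) \<Rightarrow> bool" where
  "mgrad m f g = (\<forall>y\<in>mvec m. g y \<in> mvec m \<and>
      (\<forall>\<epsilon>>0. \<exists>\<delta>>0. \<forall>h\<in>mvec m. nrm m h < \<delta> \<longrightarrow>
          \<bar>f (\<lambda>i. y i + h i) - f y - ip m (g y) h\<bar> \<le> \<epsilon> * nrm m h))"

definition mlipschitz_grad :: "nat \<Rightarrow> ((nat \<Rightarrow> real) \<Rightarrow> (nat \<Rightarrow> real)) \<Rightarrow> real \<Rightarrow> bool" where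
  "mlipschitz_grad m g L = (\<forall>y\<in>mvec m. \<forall>z\<in>mvec m. nrm m (vsub (g y) (g z)) \<le> L * nrm m (vsub y z))"

definition fstar :: "nat \<Rightarrow> ((nat \<Rightarrow> real) \<Rightarrow> real) \<Rightarrow> (nat \<Rightarrow> real) \<Rightarrow> ereal" where
  "fstar m f q = (SUP y\<in>mvec m. ereal (ip m q y - f y))"

definition subdiff :: "nat \<Rightarrow> ((nat \<Rightarrow> real) \<Rightarrow> ereal) \<Rightarrow> (nat \<Rightarrow> real) \<Rightarrow> (nat \<Rightarrow> real) set" where
  "subdiff m F q = {w \<in> mvec m. \<forall>p\<in>mvec m. F q + ereal (ip m w (vsub p q)) \<le> F p}"

definition Astar :: "nat \<Rightarrow> (nat \<Rightarrow> 'a \<Rightarrow> real) \<Rightarrow> (nat \<Rightarrow> real) \<Rightarrow> 'a \<Rightarrow> real" where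
  "Astar m a q x = (\<Sum>i<m. q i * a i x)"

text \<open>C_0(Omega): continuous on Omega and vanishing at infinity / at the boundary of Omega.\<close>
definition c0_on :: "'a::metric_space set \<Rightarrow> ('a \<Rightarrow> real) \<Rightarrow> bool" where
  "c0_on \<Omega> g = (continuous_on \<Omega> g \<and> (\<forall>\<epsilon>>0. compact {x\<in>\<Omega>. \<epsilon> \<le> \<bar>g x\<bar>}))"

text \<open>A finite signed Borel (= Radon, on R^d) measure is represented by its Jordan
  decomposition: a pair of mutually singular finite Borel measures (positive part, negative part).
  Membership in M(Omega'): both parts are concentrated on a Borel subset of Omega'.\<close>

definition smeas :: "'a::euclidean_space set \<Rightarrow> 'a measure \<times> 'a measure \<Rightarrow> bool" where
  "smeas \<Omega>' \<nu> = (sets (fst \<nu>) = sets borel \<and> sets (snd \<nu>) = sets borel \<and>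
      emeasure (fst \<nu>) (space (fst \<nu>)) < \<infinity> \<and> emeasure (snd \<nu>) (space (snd \<nu>)) < \<infinity> \<and>
      (\<exists>P\<in>sets borel. emeasure (fst \<nu>) (UNIV - P) = 0 \<and> emeasure (snd \<nu>) P = 0) \<and>
      (\<exists>B\<in>sets borel. B \<subseteq> \<Omega>' \<and> emeasure (fst \<nu>) (UNIV - B) = 0 \<and> emeasure (snd \<nu>) (UNIV - B) = 0))"

definition tvnorm :: "'a measure \<times> 'a measure \<Rightarrow> real" where
  "tvnorm \<nu> = measure (fst \<nu>) (space (fst \<nu>)) + measure (snd \<nu>) (space (snd \<nu>))"

text \<open>(A mu)_i = integral of a_i over Omega (a_i is only defined on Omega).\<close>
definition Aop :: "nat \<Rightarrow> (nat \<Rightarrow> 'a::euclidean_space \<Rightarrow> real) \<Rightarrow> 'a set \<Rightarrow> 'a measure \<times> 'a measure \<Rightarrow> nat \<Rightarrow> real" where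
  "Aop m a \<Omega> \<nu> = (\<lambda>i. if i < m then
       (\<integral>x. indicator \<Omega> x * a i x \<partial>(fst \<nu>)) - (\<integral>x. indicator \<Omega> x * a i x \<partial>(snd \<nu>)) else 0)"

definition Jfun :: "nat \<Rightarrow> (nat \<Rightarrow> 'a::euclidean_space \<Rightarrow> real) \<Rightarrow> 'a set \<Rightarrow> ((nat \<Rightarrow> real) \<Rightarrow> real)
    \<Rightarrow> 'a measure \<times> 'a measure \<Rightarrow> real" where
  "Jfun m a \<Omega> f \<nu> = tvnorm \<nu> + f (Aop m a \<Omega> \<nu>)"

definition infP :: "nat \<Rightarrow> (nat \<Rightarrow> 'a::euclidean_space \<Rightarrow> real) \<Rightarrow> 'a set \<Rightarrow> ((nat \<Rightarrow> real) \<Rightarrow> real)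
    \<Rightarrow> 'a set \<Rightarrow> real" where
  "infP m a \<Omega> f \<Omega>' = Inf (Jfun m a \<Omega> f ` {\<nu>. smeas \<Omega>' \<nu>})"

definition solvesP :: "nat \<Rightarrow> (nat \<Rightarrow> 'a::euclidean_space \<Rightarrow> real) \<Rightarrow> 'a set \<Rightarrow> ((nat \<Rightarrow> real) \<Rightarrow> real)
    \<Rightarrow> 'a set \<Rightarrow> 'a measure \<times> 'a measure \<Rightarrow> bool" where
  "solvesP m a \<Omega> f \<Omega>' \<nu> = (smeas \<Omega>' \<nu> \<and>
      (\<forall>\<nu>'. smeas \<Omega>' \<nu>' \<longrightarrow> Jfun m a \<Omega> f \<nu> \<le> Jfun m a \<Omega> f \<nu>'))"

definition feasD :: "nat \<Rightarrow> (nat \<Rightarrow> 'a \<Rightarrow> real) \<Rightarrow> 'a set \<Rightarrow> (nat \<Rightarrow> real) \<Rightarrow> bool" where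
  "feasD m a \<Omega>' q = (q \<in> mvec m \<and> (\<forall>x\<in>\<Omega>'. \<bar>Astar m a q x\<bar> \<le> 1))"

definition supD :: "nat \<Rightarrow> (nat \<Rightarrow> 'a \<Rightarrow> real) \<Rightarrow> ((nat \<Rightarrow> real) \<Rightarrow> real) \<Rightarrow> 'a set \<Rightarrow> ereal" where
  "supD m a f \<Omega>' = (SUP q\<in>{q. feasD m a \<Omega>' q}. - fstar m f q)"

definition solvesD :: "nat \<Rightarrow> (nat \<Rightarrow> 'a \<Rightarrow> real) \<Rightarrow> ((nat \<Rightarrow> real) \<Rightarrow> real) \<Rightarrow> 'a set \<Rightarrow> (nat \<Rightarrow> real) \<Rightarrow> bool" where
  "solvesD m a f \<Omega>' q = (feasD m a \<Omega>' q \<and>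
      (\<forall>p. feasD m a \<Omega>' p \<longrightarrow> - fstar m f p \<le> - fstar m f q))"

definition well_posed :: "nat \<Rightarrow> (nat \<Rightarrow> 'a::euclidean_space \<Rightarrow> real) \<Rightarrow> 'a set \<Rightarrow> ((nat \<Rightarrow> real) \<Rightarrow> real)
    \<Rightarrow> 'a set \<Rightarrow> bool" where
  "well_posed m a \<Omega> f \<Omega>' = ((\<exists>\<nu>. solvesP m a \<Omega> f \<Omega>' \<nu>) \<and> (\<exists>q. solvesD m a f \<Omega>' q) \<and>
      ereal (infP m a \<Omega> f \<Omega>') = supD m a f \<Omega>')"

text \<open>The measure sum_i alpha_i delta_{xi_i}, given by its Jordan decomposition.\<close>
definition spike_pair :: "nat \<Rightarrow> (nat \<Rightarrow> real) \<Rightarrow> (nat \<Rightarrow> 'a::euclidean_space) \<Rightarrow> 'a measure \<times> 'a measure \<Rightarrow> bool" where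
  "spike_pair s \<alpha> \<xi> \<nu> = (sets (fst \<nu>) = sets borel \<and> sets (snd \<nu>) = sets borel \<and>
      (\<forall>A\<in>sets borel.
         emeasure (fst \<nu>) A = ennreal (\<Sum>i\<in>{i. i < s \<and> 0 < \<alpha> i \<and> \<xi> i \<in> A}. \<alpha> i) \<and>
         emeasure (snd \<nu>) A = ennreal (\<Sum>i\<in>{i. i < s \<and> \<alpha> i < 0 \<and> \<xi> i \<in> A}. - \<alpha> i)))"

definition locmax_abs :: "'a::metric_space set \<Rightarrow> ('a \<Rightarrow> real) \<Rightarrow> 'a \<Rightarrow> bool" where
  "locmax_abs \<Omega> g x = (x \<in> \<Omega> \<and> (\<exists>r>0. \<forall>y\<in>\<Omega>. dist y x < r \<longrightarrow> \<bar>g y\<bar> \<le> \<bar>g x\<bar>))"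

definition exch_X :: "nat \<Rightarrow> (nat \<Rightarrow> 'a::metric_space \<Rightarrow> real) \<Rightarrow> 'a set \<Rightarrow> (nat \<Rightarrow> real) \<Rightarrow> 'a set" where
  "exch_X m a \<Omega> q = {x. locmax_abs \<Omega> (Astar m a q) x \<and> 1 < \<bar>Astar m a q x\<bar>}"

definition hdist :: "'a::metric_space set \<Rightarrow> 'a set \<Rightarrow> ereal" where
  "hdist Y Z = (if Z = {} then 0 else (SUP z\<in>Z. INF y\<in>Y. ereal (dist y z)))"

end

theory Submission
  imports Defs
begin

text \<open>
  Let \<open>\<mu>\<close> solve the primal problem on \<open>\<Omega>\<close>. The vector \<open>A \<mu>\<close> is a subgradient of \<open>f*\<close> at \<open>q*\<close>, hence
  the gap \<open>f*(q*) - f*(q_k)\<close> is at most \<open>\<parallel>\<mu>\<parallel> (M_k - 1)\<close> with \<open>M_k = max |A* q_k|\<close>, and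
  \<open>L \<parallel>\<mu>\<parallel> \<le> \<rho>\<^sup>2\<close>. Smoothness of \<open>f\<close> makes \<open>f*\<close> strongly convex, so the gap controls
  \<open>\<parallel>q_k - q*\<parallel>\<^sup>2\<close>, which in turn controls the distance of \<open>X_k\<close> to the spikes. The maximiser added at
  step \<open>k\<close> satisfies \<open>|A* q_(k+1)| \<le> 1\<close>, so \<open>M_k - 1\<close> is bounded by \<open>\<parallel>q_(k+1) - q_k\<parallel>\<close>; this
  forces the gap to tend to \<open>0\<close>.

  The linear rate comes from a pigeonhole argument. If all new points lie within \<open>\<tau>\<close> of the \<open>s\<close>
  spikes, then among boundedly many iterations two maximisers \<open>x_j\<close>, \<open>x_l\<close> with \<open>j < l\<close> are
  \<open>\<epsilon> \<tau>\<close>-close. Since \<open>|A* q_l (x_j)| \<le> 1\<close> and \<open>A* q_l\<close> is stationary at \<open>x_l\<close>, the excess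
  \<open>M_l - 1\<close> is \<open>O(\<epsilon>\<^sup>2 \<tau>\<^sup>2)\<close>. Hence the gap is \<open>O(\<epsilon>\<^sup>2 \<tau>\<^sup>2)\<close> from then on, and for small
  \<open>\<epsilon>\<close> all later new points lie within \<open>\<tau> / e\<close> of the spikes.
\<close>

section \<open>Inner product and norm on coordinate vectors\<close>

lemma nrm_eq_L2_set: "nrm m q = L2_set q {..<m}"
  by (simp add: nrm_def ip_def L2_set_def power2_eq_square)

lemma nrm_nonneg [simp]: "0 \<le> nrm m q"
  by (simp add: nrm_eq_L2_set L2_set_nonneg)

lemma ip_self: "ip m p p = (nrm m p)\<^sup>2"
  by (simp add: nrm_def ip_def sum_nonneg)

lemma abs_ip_le: "\<bar>ip m p q\<bar> \<le> nrm m p * nrm m q"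
proof -
  have "\<bar>ip m p q\<bar> \<le> (\<Sum>i<m. \<bar>p i\<bar> * \<bar>q i\<bar>)"
    unfolding ip_def by (rule order_trans[OF sum_abs]) (simp add: abs_mult)
  also have "\<dots> \<le> nrm m p * nrm m q"
    unfolding nrm_eq_L2_set by (rule L2_set_mult_ineq)
  finally show ?thesis .
qed

lemma nrm_scale: "nrm m (\<lambda>i. c * p i) = \<bar>c\<bar> * nrm m p"
proof -
  have "ip m (\<lambda>i. c * p i) (\<lambda>i. c * p i) = c\<^sup>2 * ip m p p"
    by (simp add: ip_def sum_distrib_left power2_eq_square algebra_simps)
  then show ?thesis by (simp add: nrm_def real_sqrt_mult)
qed

lemma nrm_triangle_sub: "nrm m q \<le> nrm m (vsub q p) + nrm m p"
  using L2_set_triangle_ineq[of "vsub q p" p "{..<m}"]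
  by (simp add: nrm_eq_L2_set vsub_def)

lemma nrm_vsub_commute: "nrm m (vsub p q) = nrm m (vsub q p)"
  using nrm_scale[of m "-1" "vsub q p"] by (simp add: vsub_def)

lemma abs_le_nrm: "i < m \<Longrightarrow> \<bar>p i\<bar> \<le> nrm m p"
  unfolding nrm_eq_L2_set
  using member_le_L2_set[of "{..<m}" i "\<lambda>i. \<bar>p i\<bar>"] by (simp add: L2_set_def)

lemma nrm_eq_0_mvec: "p \<in> mvec m \<Longrightarrow> q \<in> mvec m \<Longrightarrow> nrm m (vsub p q) = 0 \<Longrightarrow> p = q"
proof
  fix i assume *: "p \<in> mvec m" "q \<in> mvec m" "nrm m (vsub p q) = 0"
  show "p i = q i"
  proof (cases "i < m")
    case True
    then show ?thesis using abs_le_nrm[of i m "vsub p q"] * by (simp add: vsub_def)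
  qed (use * in \<open>simp add: mvec_def\<close>)
qed

section \<open>Smoothness of \<open>f\<close> and strong convexity of its conjugate\<close>

text \<open>Restricting \<open>f\<close> to a line makes scalar calculus, in particular the mean
  value theorem, available.\<close>

lemma mgrad_has_real_derivative:
  assumes "mgrad m f g" "y \<in> mvec m" "u \<in> mvec m"
  shows "((\<lambda>t. f (\<lambda>i. y i + t * u i)) has_real_derivative ip m (g (\<lambda>i. y i + t * u i)) u) (at t)"
  unfolding has_field_derivative_def has_derivative_at_alt
proof (intro conjI allI impI)
  show "bounded_linear ((*) (ip m (g (\<lambda>i. y i + t * u i)) u))"
    by (rule bounded_linear_mult_right)
  fix e :: real assume e: "e > 0"
  define z where "z = (\<lambda>i. y i + t * u i)"
  have z: "z \<in> mvec m" using assms by (simp add: z_def mvec_def)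
  \<comment> \<open>The \<open>+ 1\<close> keeps the quotient meaningful when \<open>u\<close> has
    norm 0.\<close>
  define e' where "e' = e / (nrm m u + 1)"
  have u1: "nrm m u + 1 > 0" using nrm_nonneg[of m u] by linarith
  have e': "e' > 0" using e u1 by (simp add: e'_def)
  obtain d where d: "d > 0"
    "\<And>h. h \<in> mvec m \<Longrightarrow> nrm m h < d \<Longrightarrow> \<bar>f (\<lambda>i. z i + h i) - f z - ip m (g z) h\<bar> \<le> e' * nrm m h"
    using assms(1) z e' unfolding mgrad_def by meson
  show "\<exists>d>0. \<forall>x. norm (x - t) < d \<longrightarrow>
      norm (f (\<lambda>i. y i + x * u i) - f (\<lambda>i. y i + t * u i) - ip m (g (\<lambda>i. y i + t * u i)) u * (x - t))
        \<le> e * norm (x - t)"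
  proof (intro exI conjI allI impI)
    show "d / (nrm m u + 1) > 0" using d u1 by simp
    fix x assume x: "norm (x - t) < d / (nrm m u + 1)"
    define h where "h = (\<lambda>i. (x - t) * u i)"
    have h: "h \<in> mvec m" using assms by (simp add: h_def mvec_def)
    have nh: "nrm m h = \<bar>x - t\<bar> * nrm m u" unfolding h_def by (rule nrm_scale)
    have "nrm m h \<le> \<bar>x - t\<bar> * (nrm m u + 1)" unfolding nh by (simp add: algebra_simps)
    also have "\<dots> < d" using x u1 by (simp add: field_simps)
    finally have "\<bar>f (\<lambda>i. z i + h i) - f z - ip m (g z) h\<bar> \<le> e' * nrm m h" using d h by blast
    moreover have "(\<lambda>i. z i + h i) = (\<lambda>i. y i + x * u i)" by (auto simp: z_def h_def algebra_simps)
    moreover have "ip m (g z) h = ip m (g z) u * (x - t)"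
      by (simp add: ip_def h_def sum_distrib_left sum_distrib_right algebra_simps)
    moreover have "e' * nrm m h \<le> e * \<bar>x - t\<bar>"
    proof -
      have "e' * nrm m h \<le> e' * (\<bar>x - t\<bar> * (nrm m u + 1))"
        unfolding nh using e' by (intro mult_left_mono mult_left_mono) auto
      also have "\<dots> = e * \<bar>x - t\<bar>" using u1 by (simp add: e'_def)
      finally show ?thesis .
    qed
    ultimately show "norm (f (\<lambda>i. y i + x * u i) - f (\<lambda>i. y i + t * u i)
        - ip m (g (\<lambda>i. y i + t * u i)) u * (x - t)) \<le> e * norm (x - t)"
      unfolding z_def by simp
  qed
qed

text \<open>The symmetric sum has the derivative <grad f(y + zu) - grad f(y - zu), u>, where the two
  points are \<open>2 * z * u\<close> apart. The mean value theorem with \<open>z < 1\<close> then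
  gives the factor 2, where integration would give 1.\<close>

lemma second_difference_le:
  assumes gr: "mgrad m f g" and lip: "mlipschitz_grad m g L" and L: "0 \<le> L"
    and y: "y \<in> mvec m" and u: "u \<in> mvec m"
  shows "f (\<lambda>i. y i + u i) + f (\<lambda>i. y i - u i) - 2 * f y \<le> 2 * L * (nrm m u)\<^sup>2"
proof -
  define u' where "u' = (\<lambda>i. - u i)"
  have u': "u' \<in> mvec m" using u by (simp add: u'_def mvec_def)
  define \<phi> where "\<phi> = (\<lambda>t. f (\<lambda>i. y i + t * u i) + f (\<lambda>i. y i + t * u' i))"
  define \<phi>' where "\<phi>' = (\<lambda>t. ip m (g (\<lambda>i. y i + t * u i)) u + ip m (g (\<lambda>i. y i + t * u' i)) u')"
  have "\<And>t. (\<phi> has_real_derivative \<phi>' t) (at t)"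
    unfolding \<phi>_def \<phi>'_def
    by (intro DERIV_add mgrad_has_real_derivative gr y u u')
  then obtain z where z: "0 < z" "z < 1" "\<phi> 1 - \<phi> 0 = (1 - 0) * \<phi>' z"
    using MVT2[of 0 1 \<phi> \<phi>'] by auto
  define p where "p = (\<lambda>i. y i + z * u i)"
  define p' where "p' = (\<lambda>i. y i + z * u' i)"
  have p: "p \<in> mvec m" "p' \<in> mvec m" using y u u' by (simp_all add: p_def p'_def mvec_def)
  have "\<phi>' z = ip m (vsub (g p) (g p')) u"
    by (simp add: \<phi>'_def u'_def p_def p'_def ip_def vsub_def algebra_simps sum_subtractf sum_negf)
  also have "\<dots> \<le> nrm m (vsub (g p) (g p')) * nrm m u"
    using abs_ip_le[of m "vsub (g p) (g p')" u] by linarith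
  also have "\<dots> \<le> (L * nrm m (vsub p p')) * nrm m u"
    using lip p unfolding mlipschitz_grad_def by (intro mult_right_mono) auto
  also have "vsub p p' = (\<lambda>i. (2 * z) * u i)"
    by (auto simp: vsub_def p_def p'_def u'_def)
  also have "L * nrm m \<dots> * nrm m u = 2 * z * (L * (nrm m u)\<^sup>2)"
    using z by (simp add: nrm_scale power2_eq_square)
  also have "\<dots> \<le> 2 * 1 * (L * (nrm m u)\<^sup>2)"
    using z L by (intro mult_right_mono mult_left_mono) auto
  finally have "\<phi> 1 - \<phi> 0 \<le> 2 * L * (nrm m u)\<^sup>2" using z by simp
  then show ?thesis by (simp add: \<phi>_def u'_def)
qed

lemma fenchel_young:
  assumes "fstar m f q = ereal v" "y \<in> mvec m"
  shows "ip m q y - f y \<le> v"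
proof -
  have "ereal (ip m q y - f y) \<le> fstar m f q"
    unfolding fstar_def using assms(2) by (intro SUP_upper)
  then show ?thesis using assms by simp
qed

text \<open>This is the dual form of the second-difference bound. The shift (p - q)/(4L) maximises
  <p - q, u> - 2L |u|^2.\<close>

lemma fstar_midpoint_le:
  assumes gr: "mgrad m f g" and lip: "mlipschitz_grad m g L" and L: "0 < L"
    and p: "p \<in> mvec m" "fstar m f p = ereal w" and q: "q \<in> mvec m" "fstar m f q = ereal v"
  shows "fstar m f (\<lambda>i. (p i + q i) / 2) \<le> ereal ((v + w) / 2 - (nrm m (vsub p q))\<^sup>2 / (16 * L))"
  unfolding fstar_def
proof (rule SUP_least)
  fix y assume y: "y \<in> mvec m"
  \<comment> \<open>Testing \<open>f*\<close> at \<open>p\<close> with \<open>y + u\<close> and at \<open>q\<close> with \<open>y - u\<close> yields the quadratic gain.\<close>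
  define u where "u = (\<lambda>i. (1 / (4 * L)) * vsub p q i)"
  have u: "u \<in> mvec m" using p q by (simp add: u_def mvec_def vsub_def)
  have yu: "(\<lambda>i. y i + u i) \<in> mvec m" "(\<lambda>i. y i - u i) \<in> mvec m"
    using y u by (auto simp: mvec_def)
  have 1: "ip m p (\<lambda>i. y i + u i) - f (\<lambda>i. y i + u i) \<le> w" by (rule fenchel_young[OF p(2) yu(1)])
  have 2: "ip m q (\<lambda>i. y i - u i) - f (\<lambda>i. y i - u i) \<le> v" by (rule fenchel_young[OF q(2) yu(2)])
  have 3: "ip m p (\<lambda>i. y i + u i) + ip m q (\<lambda>i. y i - u i)
      = 2 * ip m (\<lambda>i. (p i + q i) / 2) y + ip m (vsub p q) u"
    unfolding ip_def vsub_def sum_distrib_left sum.distrib[symmetric]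
    by (rule sum.cong) (simp_all add: field_simps)
  have 4: "f (\<lambda>i. y i + u i) + f (\<lambda>i. y i - u i) - 2 * f y \<le> 2 * L * (nrm m u)\<^sup>2"
    by (rule second_difference_le[OF gr lip _ y u]) (use L in simp)
  have 5: "ip m (vsub p q) u = (nrm m (vsub p q))\<^sup>2 / (4 * L)"
    unfolding ip_self[symmetric] by (simp add: u_def ip_def sum_divide_distrib)
  have 6: "2 * L * (nrm m u)\<^sup>2 = (nrm m (vsub p q))\<^sup>2 / (8 * L)"
    unfolding u_def nrm_scale using L by (simp add: power2_eq_square field_simps)
  define t where "t = (nrm m (vsub p q))\<^sup>2 / (8 * L)"
  have 7: "(nrm m (vsub p q))\<^sup>2 / (4 * L) = 2 * t" "(nrm m (vsub p q))\<^sup>2 / (16 * L) = t / 2"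
    using L by (simp_all add: t_def field_simps)
  have "ip m (\<lambda>i. (p i + q i) / 2) y - f y \<le> (v + w) / 2 - (nrm m (vsub p q))\<^sup>2 / (16 * L)"
    using 1 2 3 4 unfolding 5 6 7 t_def[symmetric] by (simp add: field_simps)
  then show "ereal (ip m (\<lambda>i. (p i + q i) / 2) y - f y)
      \<le> ereal ((v + w) / 2 - (nrm m (vsub p q))\<^sup>2 / (16 * L))" by simp
qed

text \<open>Optimality of \<open>q\<close> is required only against the midpoint, so the lemma
  covers both constrained dual solutions and the global minimiser of the conjugate.\<close>

lemma fstar_quadratic_growth:
  assumes gr: "mgrad m f g" and lip: "mlipschitz_grad m g L" and L: "0 < L"
    and p: "p \<in> mvec m" "fstar m f p = ereal w" and q: "q \<in> mvec m" "fstar m f q = ereal v"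
    and le: "fstar m f q \<le> fstar m f (\<lambda>i. (p i + q i) / 2)"
  shows "(nrm m (vsub p q))\<^sup>2 \<le> 8 * L * (w - v)"
proof -
  have "ereal v \<le> ereal ((v + w) / 2 - (nrm m (vsub p q))\<^sup>2 / (16 * L))"
    using order_trans[OF le fstar_midpoint_le[OF gr lip L p q]] by (simp add: q(2))
  then have "(nrm m (vsub p q))\<^sup>2 / (16 * L) \<le> (w - v) / 2" by (simp add: field_simps)
  then show ?thesis using L by (simp add: field_simps)
qed

section \<open>Functions vanishing at infinity, and bounds by operator constants\<close>

lemma c0_on_bounded:
  fixes g :: "'a::metric_space \<Rightarrow> real"
  assumes "c0_on \<Omega> g"
  shows "\<exists>B. \<forall>x\<in>\<Omega>. \<bar>g x\<bar> \<le> B"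
proof -
  define K where "K = {x\<in>\<Omega>. 1 \<le> \<bar>g x\<bar>}"
  have "compact K" using assms by (simp add: c0_on_def K_def)
  moreover have "continuous_on K g" using assms
    by (auto simp: c0_on_def K_def intro: continuous_on_subset)
  ultimately have "bounded (g ` K)" by (intro compact_imp_bounded compact_continuous_image)
  then obtain B where B: "\<And>x. x \<in> K \<Longrightarrow> \<bar>g x\<bar> \<le> B" by (auto simp: bounded_iff)
  have "\<bar>g x\<bar> \<le> max B 1" if "x \<in> \<Omega>" for x
    using B[of x] that by (cases "x \<in> K") (auto simp: K_def)
  then show ?thesis by blast
qed

text \<open>A superlevel set of the combination lies in a finite union of compact superlevel sets of
  the \<open>a i\<close>, and is closed there.\<close>

lemma c0_on_Astar:
  fixes a :: "nat \<Rightarrow> 'a::metric_space \<Rightarrow> real"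
  assumes a: "\<And>i. i < m \<Longrightarrow> c0_on \<Omega> (a i)"
  shows "c0_on \<Omega> (Astar m a p)"
  unfolding c0_on_def
proof (intro conjI allI impI)
  show cont: "continuous_on \<Omega> (Astar m a p)"
    unfolding Astar_def using a by (intro continuous_intros) (auto simp: c0_on_def)
  fix e :: real assume e: "e > 0"
  \<comment> \<open>If every \<open>\<bar>a i x\<bar>\<close> is at most \<open>d\<close>, the
    combination stays strictly below \<open>e\<close>; the \<open>+ 1\<close> terms exclude division
    by zero and give strictness.\<close>
  define d where "d = e / ((nrm m p + 1) * (real m + 1))"
  have n1: "nrm m p + 1 > 0" using nrm_nonneg[of m p] by linarith
  have d: "d > 0" using e n1 by (simp add: d_def)
  define K where "K = (\<Union>i<m. {x\<in>\<Omega>. d \<le> \<bar>a i x\<bar>})"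
  have K: "compact K" unfolding K_def using a d
    by (intro compact_UN) (auto simp: c0_on_def)
  have K\<Omega>: "K \<subseteq> \<Omega>" by (auto simp: K_def)
  have sub: "{x\<in>\<Omega>. e \<le> \<bar>Astar m a p x\<bar>} \<subseteq> K"
  proof
    fix x assume x: "x \<in> {x\<in>\<Omega>. e \<le> \<bar>Astar m a p x\<bar>}"
    show "x \<in> K"
    proof (rule ccontr)
      assume "x \<notin> K"
      then have sm: "\<bar>a i x\<bar> \<le> d" if "i < m" for i using x that by (force simp: K_def)
      have "\<bar>Astar m a p x\<bar> \<le> (\<Sum>i<m. \<bar>p i * a i x\<bar>)" unfolding Astar_def by (rule sum_abs)
      also have "\<dots> \<le> (\<Sum>i<m. nrm m p * d)"
        by (intro sum_mono) (auto simp: abs_mult intro!: mult_mono sm abs_le_nrm)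
      also have "\<dots> = real m * nrm m p * d" by simp
      also have "\<dots> \<le> real m * ((nrm m p + 1) * d)" using d by (simp add: algebra_simps)
      also have "\<dots> < (real m + 1) * ((nrm m p + 1) * d)" using d n1 by simp
      also have "\<dots> = e" using n1 by (simp add: d_def)
      finally show False using x by simp
    qed
  qed
  have "{x\<in>\<Omega>. e \<le> \<bar>Astar m a p x\<bar>} = {x\<in>K. e \<le> \<bar>Astar m a p x\<bar>}" using sub K\<Omega> by auto
  moreover have "closed {x\<in>K. e \<le> \<bar>Astar m a p x\<bar>}"
  proof -
    have "continuous_on K (\<lambda>x. \<bar>Astar m a p x\<bar>)"
      by (intro continuous_intros continuous_on_subset[OF cont K\<Omega>])
    from continuous_closed_preimage[OF this compact_imp_closed[OF K], of "{e..}"]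
    show ?thesis by (simp add: vimage_def Int_def)
  qed
  ultimately show "compact {x\<in>\<Omega>. e \<le> \<bar>Astar m a p x\<bar>}"
    using K sub by (metis (no_types, lifting) closed_Int_compact inf.absorb1)
qed

text \<open>A nonzero value yields a nonempty compact superlevel set, on which the maximum is
  attained; points outside it have smaller values.\<close>

lemma c0_on_attains_max:
  fixes g :: "'a::metric_space \<Rightarrow> real"
  assumes g: "c0_on \<Omega> g" and y: "y \<in> \<Omega>" "g y \<noteq> 0"
  shows "\<exists>x\<in>\<Omega>. \<forall>z\<in>\<Omega>. \<bar>g z\<bar> \<le> \<bar>g x\<bar>"
proof -
  define K where "K = {x\<in>\<Omega>. \<bar>g y\<bar> \<le> \<bar>g x\<bar>}"
  have "compact K" using g y by (simp add: c0_on_def K_def)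
  moreover have "continuous_on K (\<lambda>x. \<bar>g x\<bar>)" using g
    by (intro continuous_intros) (auto simp: c0_on_def K_def intro: continuous_on_subset)
  moreover have "K \<noteq> {}" using y by (auto simp: K_def)
  ultimately obtain x where x: "x \<in> K" "\<And>z. z \<in> K \<Longrightarrow> \<bar>g z\<bar> \<le> \<bar>g x\<bar>"
    using continuous_attains_sup[of K "\<lambda>x. \<bar>g x\<bar>"] by blast
  have "\<bar>g z\<bar> \<le> \<bar>g x\<bar>" if "z \<in> \<Omega>" for z
    using x that by (cases "z \<in> K") (auto simp: K_def)
  then show ?thesis using x by (auto simp: K_def)
qed

text \<open>Homogeneity in \<open>p\<close>. The vectors \<open>V\<close> are left abstract so that
  gradients and Hessians are both covered. A real \<open>Sup\<close> bounds its set only if that set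
  is bounded above, which the uniform bound \<open>B\<close> ensures.\<close>

lemma norm_sum_le_Sup_unit:
  fixes V :: "nat \<Rightarrow> 'x \<Rightarrow> 'b::real_normed_vector"
  assumes V: "\<And>i x. i < m \<Longrightarrow> x \<in> \<Omega> \<Longrightarrow> norm (V i x) \<le> B"
    and p: "p \<in> mvec m" and x: "x \<in> \<Omega>"
  shows "norm (\<Sum>i<m. p i *\<^sub>R V i x)
    \<le> Sup {norm (\<Sum>i<m. p i *\<^sub>R V i x) | p x. p \<in> mvec m \<and> nrm m p \<le> 1 \<and> x \<in> \<Omega>} * nrm m p"
    (is "_ \<le> Sup ?S * _")
proof -
  have bdd: "bdd_above ?S"
  proof (rule bdd_aboveI)
    fix z assume "z \<in> ?S"
    then obtain p x where px: "z = norm (\<Sum>i<m. p i *\<^sub>R V i x)" "nrm m p \<le> 1" "x \<in> \<Omega>" by auto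
    have "z \<le> (\<Sum>i<m. norm (p i *\<^sub>R V i x))" unfolding px by (rule norm_sum)
    also have "\<dots> \<le> (\<Sum>i<m. 1 * B)"
    proof (rule sum_mono)
      fix i assume "i \<in> {..<m}"
      then have "\<bar>p i\<bar> * norm (V i x) \<le> 1 * B"
        using px V abs_le_nrm[of i m p] by (intro mult_mono) force+
      then show "norm (p i *\<^sub>R V i x) \<le> 1 * B" by simp
    qed
    finally show "z \<le> (\<Sum>i<m. 1 * B)" .
  qed
  show ?thesis
  proof (cases "nrm m p = 0")
    case True
    then have "p i = 0" if "i < m" for i using abs_le_nrm[OF that, of p] by simp
    then show ?thesis using True by simp
  next
    case False
    then have pos: "nrm m p > 0" using nrm_nonneg[of m p] by linarith
    define p' where "p' = (\<lambda>i. (1 / nrm m p) * p i)"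
    have "p' \<in> mvec m" "nrm m p' \<le> 1" unfolding p'_def nrm_scale using p pos by (auto simp: mvec_def)
    then have "norm (\<Sum>i<m. p' i *\<^sub>R V i x) \<le> Sup ?S"
      using x by (intro cSup_upper bdd) blast
    moreover have "(\<Sum>i<m. p' i *\<^sub>R V i x) = (1 / nrm m p) *\<^sub>R (\<Sum>i<m. p i *\<^sub>R V i x)"
      by (simp add: p'_def scaleR_sum_right)
    ultimately show ?thesis using pos by (simp add: field_simps)
  qed
qed

section \<open>Pairing with measures\<close>

lemma Aop_in_mvec: "Aop m a \<Omega> \<nu> \<in> mvec m"
  by (simp add: Aop_def mvec_def)

text \<open>The pairing <p, A nu> is the integral of A* p against nu; it is estimated on each Jordan
  part separately, so that the two masses add up to the total variation.\<close>

lemma abs_ip_Aop_le: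
  fixes a :: "nat \<Rightarrow> 'a::euclidean_space \<Rightarrow> real"
  assumes op: "open \<Omega>" and a: "\<And>i. i < m \<Longrightarrow> c0_on \<Omega> (a i)" and nu: "smeas \<Omega> \<nu>"
    and M: "\<And>x. x \<in> \<Omega> \<Longrightarrow> \<bar>Astar m a p x\<bar> \<le> M" "0 \<le> M"
  shows "\<bar>ip m p (Aop m a \<Omega> \<nu>)\<bar> \<le> M * tvnorm \<nu>"
proof -
  have int: "integrable N (\<lambda>x. indicator \<Omega> x * a i x)"
    if N: "sets N = sets borel" "emeasure N (space N) < \<infinity>" and i: "i < m" for N i
  proof -
    interpret finite_measure N by standard (use N in auto)
    obtain B where B: "\<And>x. x \<in> \<Omega> \<Longrightarrow> \<bar>a i x\<bar> \<le> B" using c0_on_bounded[OF a[OF i]] by blast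
    have "(\<lambda>x. indicator \<Omega> x *\<^sub>R a i x) \<in> borel_measurable borel"
      using a[OF i] op by (intro borel_measurable_continuous_on_indicator) (auto simp: c0_on_def)
    then have "(\<lambda>x. indicator \<Omega> x * a i x) \<in> borel_measurable N"
      using N by (simp cong: measurable_cong_sets)
    then show ?thesis
      by (rule integrable_const_bound[where B="max B 0", rotated])
         (auto simp: indicator_def intro!: AE_I2 B max.coboundedI1)
  qed
  have bnd: "\<bar>\<Sum>i<m. p i * (\<integral>x. indicator \<Omega> x * a i x \<partial>N)\<bar> \<le> M * measure N (space N)"
    if N: "sets N = sets borel" "emeasure N (space N) < \<infinity>" for N
  proof -
    interpret finite_measure N by standard (use N in auto)
    have "(\<Sum>i<m. p i * (\<integral>x. indicator \<Omega> x * a i x \<partial>N))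
        = (\<integral>x. (\<Sum>i<m. p i * (indicator \<Omega> x * a i x)) \<partial>N)"
      using int[OF N] by (subst Bochner_Integration.integral_sum) auto
    also have "norm \<dots> \<le> (\<integral>x. norm (\<Sum>i<m. p i * (indicator \<Omega> x * a i x)) \<partial>N)"
      by (rule integral_norm_bound)
    also have "\<dots> \<le> (\<integral>x. M \<partial>N)"
    proof (rule integral_mono)
      show "integrable N (\<lambda>x. norm (\<Sum>i<m. p i * (indicator \<Omega> x * a i x)))"
        using int[OF N] by (intro integrable_norm Bochner_Integration.integrable_sum) auto
      fix x
      show "norm (\<Sum>i<m. p i * (indicator \<Omega> x * a i x)) \<le> M"
        using M by (cases "x \<in> \<Omega>") (auto simp: Astar_def)
    qed simp
    finally show ?thesis by (simp add: mult.commute)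
  qed
  have "ip m p (Aop m a \<Omega> \<nu>) = (\<Sum>i<m. p i * (\<integral>x. indicator \<Omega> x * a i x \<partial>(fst \<nu>)))
      - (\<Sum>i<m. p i * (\<integral>x. indicator \<Omega> x * a i x \<partial>(snd \<nu>)))"
    by (simp add: ip_def Aop_def sum_subtractf algebra_simps)
  moreover have "\<bar>\<Sum>i<m. p i * (\<integral>x. indicator \<Omega> x * a i x \<partial>(fst \<nu>))\<bar> \<le> M * measure (fst \<nu>) (space (fst \<nu>))"
    "\<bar>\<Sum>i<m. p i * (\<integral>x. indicator \<Omega> x * a i x \<partial>(snd \<nu>))\<bar> \<le> M * measure (snd \<nu>) (space (snd \<nu>))"
    using nu by (auto simp: smeas_def intro!: bnd)
  ultimately show ?thesis unfolding tvnorm_def distrib_left by linarith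
qed

section \<open>Solutions of the dual problem\<close>

lemma feasD_midpoint:
  assumes "feasD m a \<Omega>' p" "feasD m a \<Omega>' q"
  shows "feasD m a \<Omega>' (\<lambda>i. (p i + q i) / 2)"
  unfolding feasD_def
proof (intro conjI ballI)
  show "(\<lambda>i. (p i + q i) / 2) \<in> mvec m" using assms by (simp add: feasD_def mvec_def)
  fix x assume x: "x \<in> \<Omega>'"
  have "Astar m a (\<lambda>i. (p i + q i) / 2) x = (Astar m a p x + Astar m a q x) / 2"
    unfolding Astar_def sum.distrib[symmetric] sum_divide_distrib
    by (rule sum.cong) (simp_all add: field_simps)
  moreover have "\<bar>Astar m a p x\<bar> \<le> 1" "\<bar>Astar m a q x\<bar> \<le> 1" using assms x by (auto simp: feasD_def)
  ultimately show "\<bar>Astar m a (\<lambda>i. (p i + q i) / 2) x\<bar> \<le> 1" by (simp add: abs_le_iff)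
qed

text \<open>The absence of a duality gap makes the extended-real conjugate finite at dual solutions,
  so that later estimates are over the reals.\<close>

lemma fstar_solvesD:
  assumes "well_posed m a \<Omega> f \<Omega>'" "solvesD m a f \<Omega>' p"
  shows "fstar m f p = ereal (- infP m a \<Omega> f \<Omega>')"
proof -
  have "supD m a f \<Omega>' = - fstar m f p"
    unfolding supD_def using assms(2) unfolding solvesD_def
    by (intro antisym SUP_least SUP_upper) auto
  then have "ereal (infP m a \<Omega> f \<Omega>') = - fstar m f p" using assms(1) by (simp add: well_posed_def)
  then show ?thesis by (metis ereal_uminus_uminus uminus_ereal.simps(1))
qed

lemma infP_eq_Jfun:
  assumes "solvesP m a \<Omega> f \<Omega>' \<nu>"
  shows "infP m a \<Omega> f \<Omega>' = Jfun m a \<Omega> f \<nu>"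
  unfolding infP_def using assms unfolding solvesP_def
  by (intro cInf_eq_minimum) auto

text \<open>The feasible set is convex, so the midpoint is an admissible competitor for
  \<open>q\<close>.\<close>

lemma solvesD_quadratic_growth:
  assumes gr: "mgrad m f g" and lip: "mlipschitz_grad m g L" and L: "0 < L"
    and q: "solvesD m a f \<Omega>' q" "fstar m f q = ereal v"
    and p: "feasD m a \<Omega>' p" "fstar m f p = ereal w"
  shows "(nrm m (vsub p q))\<^sup>2 \<le> 8 * L * (w - v)"
proof (rule fstar_quadratic_growth[OF gr lip L])
  have "feasD m a \<Omega>' q" using q by (simp add: solvesD_def)
  then have "feasD m a \<Omega>' (\<lambda>i. (p i + q i) / 2)" using p by (intro feasD_midpoint)
  then show "fstar m f q \<le> fstar m f (\<lambda>i. (p i + q i) / 2)"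
    using q(1) by (simp add: solvesD_def)
qed (use p q in \<open>auto simp: feasD_def solvesD_def\<close>)

lemma Astar_vsub: "Astar m a (vsub p q) x = Astar m a p x - Astar m a q x"
  by (simp add: Astar_def vsub_def algebra_simps sum_subtractf)

text \<open>Intermediate value theorem. It serves to replace an absolute value along a segment by a
  fixed sign times the function.\<close>

lemma sgn_constant_on_connected:
  fixes \<phi> :: "'x::topological_space \<Rightarrow> real"
  assumes S: "connected S" "continuous_on S \<phi>" "\<And>x. x \<in> S \<Longrightarrow> \<phi> x \<noteq> 0" and xy: "x \<in> S" "y \<in> S"
  shows "sgn (\<phi> x) = sgn (\<phi> y)"
proof (rule ccontr)
  assume neq: "sgn (\<phi> x) \<noteq> sgn (\<phi> y)"
  have con: "connected (\<phi> ` S)" using S by (intro connected_continuous_image)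
  have "0 \<in> \<phi> ` S"
  proof (cases "\<phi> x \<le> 0")
    case True
    then have "0 \<le> \<phi> y" using neq S(3) xy by (auto simp: sgn_if split: if_splits)
    then show ?thesis using connectedD_interval[OF con, of "\<phi> x" "\<phi> y" 0] True xy by auto
  next
    case False
    then have "\<phi> y \<le> 0" using neq by (auto simp: sgn_if split: if_splits)
    then show ?thesis using connectedD_interval[OF con, of "\<phi> y" "\<phi> x" 0] False xy by auto
  qed
  then show False using S(3) by auto
qed

section \<open>The setting of the exchange algorithm\<close>

text \<open>The operator constants enter only as upper bounds of unspecified sign, hence the
  absolute values around them below. The Lipschitz constant is kept out of the locale so that growth
  estimates can be instantiated with several constants.\<close>

locale exchange_setting =
  fixes \<Omega> :: "'a::euclidean_space set" and m :: nat and a :: "nat \<Rightarrow> 'a \<Rightarrow> real"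
    and Da :: "nat \<Rightarrow> 'a \<Rightarrow> 'a" and H :: "nat \<Rightarrow> 'a \<Rightarrow> 'a \<Rightarrow>\<^sub>L 'a"
    and f :: "(nat \<Rightarrow> real) \<Rightarrow> real" and g :: "(nat \<Rightarrow> real) \<Rightarrow> (nat \<Rightarrow> real)"
    and s :: nat and \<xi> :: "nat \<Rightarrow> 'a" and qs :: "nat \<Rightarrow> real"
    and Om :: "nat \<Rightarrow> 'a set" and q :: "nat \<Rightarrow> nat \<Rightarrow> real"
    and \<gamma> \<tau>\<^sub>0 \<kappa>\<^sub>g \<kappa>\<^sub>h :: real
  assumes open_\<Omega>: "open \<Omega>" and convex_\<Omega>: "convex \<Omega>"
    and c0: "\<And>i. i < m \<Longrightarrow> c0_on \<Omega> (a i)"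
    and deriv_a: "\<And>i x. i < m \<Longrightarrow> x \<in> \<Omega> \<Longrightarrow> (a i has_derivative (\<lambda>h. Da i x \<bullet> h)) (at x)"
    and deriv_Da: "\<And>i x. i < m \<Longrightarrow> x \<in> \<Omega> \<Longrightarrow> (Da i has_derivative blinfun_apply (H i x)) (at x)"
    and grad_bound: "\<And>p x. p \<in> mvec m \<Longrightarrow> x \<in> \<Omega> \<Longrightarrow> norm (\<Sum>i<m. p i *\<^sub>R Da i x) \<le> \<kappa>\<^sub>g * nrm m p"
    and hess_bound: "\<And>p x. p \<in> mvec m \<Longrightarrow> x \<in> \<Omega> \<Longrightarrow> norm (\<Sum>i<m. p i *\<^sub>R H i x) \<le> \<kappa>\<^sub>h * nrm m p"
    and grad_f: "mgrad m f g"
    and qs: "solvesD m a f \<Omega> qs"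
    and spikes: "\<And>i. i < s \<Longrightarrow> \<xi> i \<in> \<Omega>" "\<And>i. i < s \<Longrightarrow> \<bar>Astar m a qs (\<xi> i)\<bar> = 1"
    and pos: "0 < \<gamma>" "0 < \<tau>\<^sub>0"
    and near: "\<And>x i. x \<in> \<Omega> \<Longrightarrow> i < s \<Longrightarrow> dist x (\<xi> i) \<le> \<tau>\<^sub>0 \<Longrightarrow> \<gamma> * \<tau>\<^sub>0\<^sup>2 / 2 \<le> \<bar>Astar m a qs x\<bar>"
    and concave: "\<And>x i h. x \<in> \<Omega> \<Longrightarrow> i < s \<Longrightarrow> dist x (\<xi> i) \<le> \<tau>\<^sub>0 \<Longrightarrow>
       h \<bullet> (sgn (Astar m a qs x) *\<^sub>R blinfun_apply (\<Sum>i<m. qs i *\<^sub>R H i x) h) \<le> - \<gamma> * (norm h)\<^sup>2"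
    and far: "\<And>x. x \<in> \<Omega> \<Longrightarrow> (\<forall>i<s. \<tau>\<^sub>0 \<le> dist x (\<xi> i)) \<Longrightarrow> \<bar>Astar m a qs x\<bar> \<le> 1 - \<gamma> * \<tau>\<^sub>0\<^sup>2 / 2"
    and wp: "well_posed m a \<Omega> f \<Omega>"
    and Om_0: "Om 0 \<subseteq> \<Omega>"
    and wp_Om: "\<And>k. well_posed m a \<Omega> f (Om k)"
    and q: "\<And>k. solvesD m a f (Om k) (q k)"
    and Om_Suc: "\<And>k. Om (Suc k) = Om k \<union> exch_X m a \<Omega> (q k)"
begin

abbreviation grad :: "(nat \<Rightarrow> real) \<Rightarrow> 'a \<Rightarrow> 'a" where
  "grad p x \<equiv> \<Sum>i<m. p i *\<^sub>R Da i x"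

abbreviation hess :: "(nat \<Rightarrow> real) \<Rightarrow> 'a \<Rightarrow> 'a \<Rightarrow>\<^sub>L 'a" where
  "hess p x \<equiv> \<Sum>i<m. p i *\<^sub>R H i x"

abbreviation X :: "nat \<Rightarrow> 'a set" where
  "X k \<equiv> exch_X m a \<Omega> (q k)"

definition gap :: "nat \<Rightarrow> real" where
  "gap k = infP m a \<Omega> f (Om k) - infP m a \<Omega> f \<Omega>"

section \<open>Derivatives of dual certificates and bookkeeping of the iterates\<close>

lemma Astar_derivative:
  assumes "x \<in> \<Omega>"
  shows "(Astar m a p has_derivative (\<lambda>h. grad p x \<bullet> h)) (at x)"
  unfolding Astar_def inner_sum_left inner_scaleR_left using assms
  by (intro has_derivative_sum has_derivative_mult_right deriv_a) auto

lemma grad_derivative: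
  assumes "x \<in> \<Omega>"
  shows "(grad p has_derivative blinfun_apply (hess p x)) (at x)"
proof -
  have "(grad p has_derivative (\<lambda>h. \<Sum>i<m. p i *\<^sub>R blinfun_apply (H i x) h)) (at x)"
    using assms by (intro has_derivative_sum has_derivative_scaleR_right deriv_Da) auto
  moreover have "(\<lambda>h. \<Sum>i<m. p i *\<^sub>R blinfun_apply (H i x) h) = blinfun_apply (hess p x)"
    by (rule ext) (simp add: blinfun.sum_left blinfun.scaleR_left)
  ultimately show ?thesis by simp
qed

lemma continuous_on_Astar: "continuous_on \<Omega> (Astar m a p)"
  using c0_on_Astar[of m \<Omega> a p] c0 by (auto simp: c0_on_def)

text \<open>The constant may depend on the functions \<open>a i\<close>: it is used for the
  qualitative convergence of the gap and for the choice of a starting index, never for the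
  rate.\<close>

lemma Astar_le_nrm: "\<exists>K>0. \<forall>p. \<forall>x\<in>\<Omega>. \<bar>Astar m a p x\<bar> \<le> K * nrm m p"
proof -
  have "\<forall>i\<in>{..<m}. \<exists>B. \<forall>x\<in>\<Omega>. \<bar>a i x\<bar> \<le> B" using c0_on_bounded[OF c0] by auto
  then obtain B where B: "\<And>i x. i < m \<Longrightarrow> x \<in> \<Omega> \<Longrightarrow> \<bar>a i x\<bar> \<le> B i"
    using bchoice[of "{..<m}"] by (metis lessThan_iff)
  define K where "K = (\<Sum>i<m. \<bar>B i\<bar>) + 1"
  have "\<bar>Astar m a p x\<bar> \<le> K * nrm m p" if x: "x \<in> \<Omega>" for p x
  proof -
    have "\<bar>Astar m a p x\<bar> \<le> (\<Sum>i<m. \<bar>p i * a i x\<bar>)" unfolding Astar_def by (rule sum_abs)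
    also have "\<dots> \<le> (\<Sum>i<m. nrm m p * \<bar>B i\<bar>)"
    proof (rule sum_mono)
      fix i assume "i \<in> {..<m}"
      then show "\<bar>p i * a i x\<bar> \<le> nrm m p * \<bar>B i\<bar>"
        unfolding abs_mult using B[of i x] x abs_le_nrm[of i m p] by (intro mult_mono) auto
    qed
    also have "\<dots> \<le> K * nrm m p"
      by (simp add: K_def sum_distrib_left[symmetric] algebra_simps)
    finally show ?thesis .
  qed
  moreover have "K > 0" unfolding K_def by (intro add_nonneg_pos sum_nonneg) auto
  ultimately show ?thesis by blast
qed

text \<open>Fermat's rule is applied to the function times its sign at \<open>x\<close>, which
  avoids differentiating the absolute value.\<close>

lemma grad_eq_0_at_locmax:
  assumes "locmax_abs \<Omega> (Astar m a p) x"
  shows "grad p x = 0 \<or> Astar m a p x = 0"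
proof (cases "Astar m a p x = 0")
  case False
  define \<sigma> where "\<sigma> = sgn (Astar m a p x)"
  obtain r where r: "x \<in> \<Omega>" "r > 0" "\<And>y. y \<in> \<Omega> \<Longrightarrow> dist y x < r \<Longrightarrow> \<bar>Astar m a p y\<bar> \<le> \<bar>Astar m a p x\<bar>"
    using assms by (auto simp: locmax_abs_def)
  have der: "((\<lambda>y. \<sigma> * Astar m a p y) has_derivative (\<lambda>h. \<sigma> * (grad p x \<bullet> h))) (at x)"
    by (intro has_derivative_mult_right Astar_derivative r)
  have "(\<lambda>h. \<sigma> * (grad p x \<bullet> h)) = (\<lambda>h. 0)"
  proof (rule differential_zero_maxmin[OF _ _ der])
    show "x \<in> \<Omega> \<inter> ball x r" "open (\<Omega> \<inter> ball x r)" using r open_\<Omega> by auto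
    have "\<sigma> * Astar m a p y \<le> \<sigma> * Astar m a p x" if "y \<in> \<Omega> \<inter> ball x r" for y
    proof -
      have "\<sigma> * Astar m a p y \<le> \<bar>Astar m a p y\<bar>" using False by (auto simp: \<sigma>_def sgn_if)
      also have "\<dots> \<le> \<bar>Astar m a p x\<bar>" using r that by (auto simp: dist_commute)
      also have "\<dots> = \<sigma> * Astar m a p x" by (auto simp: \<sigma>_def sgn_if)
      finally show ?thesis .
    qed
    then show "(\<forall>y\<in>\<Omega> \<inter> ball x r. \<sigma> * Astar m a p y \<le> \<sigma> * Astar m a p x) \<or>
      (\<forall>y\<in>\<Omega> \<inter> ball x r. \<sigma> * Astar m a p x \<le> \<sigma> * Astar m a p y)" by blast
  qed
  from fun_cong[OF this, of "grad p x"] show ?thesis using False by (auto simp: \<sigma>_def sgn_zero_iff)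
qed simp

lemma exch_X_D:
  assumes "x \<in> X k"
  shows "x \<in> \<Omega>" "1 < \<bar>Astar m a (q k) x\<bar>" "grad (q k) x = 0"
  using assms grad_eq_0_at_locmax[of "q k" x] by (auto simp: exch_X_def locmax_abs_def)

lemma Om_subset: "Om k \<subseteq> \<Omega>"
  by (induction k) (use Om_0 Om_Suc exch_X_D in auto)

lemma Om_mono: "j \<le> k \<Longrightarrow> Om j \<subseteq> Om k"
  by (rule lift_Suc_mono_le) (simp_all add: Om_Suc)

lemma X_subset_Om: "j < k \<Longrightarrow> X j \<subseteq> Om k"
  using Om_mono[of "Suc j" k] Om_Suc by auto

lemma q_mvec: "q k \<in> mvec m" "qs \<in> mvec m"
  using q[of k] qs by (auto simp: solvesD_def feasD_def)

lemma vsub_mvec: "p \<in> mvec m \<Longrightarrow> p' \<in> mvec m \<Longrightarrow> vsub p p' \<in> mvec m"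
  by (simp add: mvec_def vsub_def)

lemma Astar_q_le_1: "x \<in> Om k \<Longrightarrow> \<bar>Astar m a (q k) x\<bar> \<le> 1"
  using q[of k] by (simp add: solvesD_def feasD_def)

lemma Astar_qs_le_1: "x \<in> \<Omega> \<Longrightarrow> \<bar>Astar m a qs x\<bar> \<le> 1"
  using qs by (simp add: solvesD_def feasD_def)

lemma feasible_qs: "feasD m a (Om k) qs"
  using qs Om_subset[of k] by (auto simp: solvesD_def feasD_def)

lemma feasible_q: "j \<le> k \<Longrightarrow> feasD m a (Om j) (q k)"
  using q[of k] Om_mono[of j k] by (auto simp: solvesD_def feasD_def)

lemma fstar_q: "fstar m f (q k) = ereal (- infP m a \<Omega> f (Om k))"
  using fstar_solvesD wp_Om q by blast

lemma fstar_qs: "fstar m f qs = ereal (- infP m a \<Omega> f \<Omega>)"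
  using fstar_solvesD wp qs by blast

section \<open>The duality gap and its decay to zero\<close>

lemma gap_nonneg: "0 \<le> gap k"
proof -
  have "- fstar m f qs \<le> - fstar m f (q k)"
    using q[of k] feasible_qs[of k] by (simp add: solvesD_def)
  then show ?thesis unfolding fstar_q fstar_qs by (simp add: gap_def)
qed

lemma gap_mono: "j \<le> k \<Longrightarrow> gap k \<le> gap j"
proof -
  assume "j \<le> k"
  then have "- fstar m f (q k) \<le> - fstar m f (q j)"
    using q[of j] feasible_q[of j k] by (simp add: solvesD_def)
  then show ?thesis unfolding fstar_q by (simp add: gap_def)
qed

text \<open>\<open>qs\<close> competes with \<open>q k\<close> on the larger feasible set belonging
  to \<open>Om k\<close>.\<close>

lemma nrm_sq_le_gap:
  assumes "mlipschitz_grad m g L" "0 < L"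
  shows "(nrm m (vsub (q k) qs))\<^sup>2 \<le> 8 * L * gap k"
  using solvesD_quadratic_growth[OF grad_f assms q fstar_q feasible_qs fstar_qs, of k]
  by (simp add: gap_def nrm_vsub_commute)

text \<open>Here the competitor is the next iterate, so the right-hand side is a decrement of a
  monotone sequence.\<close>

lemma nrm_sq_le_gap_diff:
  assumes "mlipschitz_grad m g L" "0 < L"
  shows "(nrm m (vsub (q (Suc k)) (q k)))\<^sup>2 \<le> 8 * L * (gap k - gap (Suc k))"
  using solvesD_quadratic_growth[OF grad_f assms q fstar_q feasible_q fstar_q, of k "Suc k"]
  by (simp add: gap_def)

text \<open>\<open>w\<close> is the image of a primal solution and \<open>T\<close> its total
  variation. Fenchel's inequality gives <q*, w> <= -T and feasibility of q* gives the converse.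
  Fenchel's inequality at q_k together with <q_k, w> >= -M T bounds the gap.\<close>

lemma dual_certificate:
  obtains w T where "w \<in> subdiff m (fstar m f) qs" "ip m w qs = - T" "0 \<le> T"
    "\<And>k M. 0 \<le> M \<Longrightarrow> (\<And>x. x \<in> \<Omega> \<Longrightarrow> \<bar>Astar m a (q k) x\<bar> \<le> M) \<Longrightarrow> gap k \<le> T * (M - 1)"
proof -
  obtain \<nu> where \<nu>: "solvesP m a \<Omega> f \<Omega> \<nu>" using wp by (auto simp: well_posed_def)
  define w where "w = Aop m a \<Omega> \<nu>"
  define T where "T = tvnorm \<nu>"
  have sm: "smeas \<Omega> \<nu>" using \<nu> by (simp add: solvesP_def)
  have w: "w \<in> mvec m" by (simp add: w_def Aop_in_mvec)
  have T: "0 \<le> T" by (simp add: T_def tvnorm_def)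
  have opt: "infP m a \<Omega> f \<Omega> = T + f w"
    using infP_eq_Jfun[OF \<nu>] by (simp add: Jfun_def T_def w_def)
  have ub: "\<bar>ip m p w\<bar> \<le> M * T"
    if "0 \<le> M" "\<And>x. x \<in> \<Omega> \<Longrightarrow> \<bar>Astar m a p x\<bar> \<le> M" for M p
    unfolding w_def T_def using that by (intro abs_ip_Aop_le[OF open_\<Omega> c0 sm]) auto
  have "ip m qs w - f w \<le> - infP m a \<Omega> f \<Omega>" by (rule fenchel_young[OF fstar_qs w])
  moreover have "\<bar>ip m qs w\<bar> \<le> 1 * T" by (rule ub) (auto simp: Astar_qs_le_1)
  ultimately have ipT: "ip m qs w = - T" using opt by linarith
  show thesis
  proof (rule that)
    show "w \<in> subdiff m (fstar m f) qs"
      unfolding subdiff_def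
    proof (intro CollectI conjI ballI w)
      fix p assume "p \<in> mvec m"
      have "ereal (ip m p w - f w) \<le> fstar m f p" unfolding fstar_def by (rule SUP_upper[OF w])
      moreover have "ip m w (vsub p qs) = ip m p w - ip m qs w"
        by (simp add: ip_def vsub_def sum_subtractf algebra_simps)
      ultimately show "fstar m f qs + ereal (ip m w (vsub p qs)) \<le> fstar m f p"
        unfolding fstar_qs using ipT opt by simp
    qed
    show "ip m w qs = - T" using ipT by (simp add: ip_def mult.commute)
    show "0 \<le> T" by (rule T)
    fix k M assume M: "0 \<le> M" "\<And>x. x \<in> \<Omega> \<Longrightarrow> \<bar>Astar m a (q k) x\<bar> \<le> M"
    have "ip m (q k) w - f w \<le> - infP m a \<Omega> f (Om k)" by (rule fenchel_young[OF fstar_q w])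
    moreover have "\<bar>ip m (q k) w\<bar> \<le> M * T" by (rule ub[OF M])
    ultimately show "gap k \<le> T * (M - 1)"
      unfolding gap_def opt by (simp add: algebra_simps)
  qed
qed

text \<open>Where the constraint is violated somewhere, a global maximiser exists by decay at
  infinity, and it is in particular one of the added local maximisers.\<close>

lemma maximizer_or_feasible:
  obtains (feasible) "\<And>x. x \<in> \<Omega> \<Longrightarrow> \<bar>Astar m a (q k) x\<bar> \<le> 1"
  | (maximizer) x where "x \<in> X k" "\<And>z. z \<in> \<Omega> \<Longrightarrow> \<bar>Astar m a (q k) z\<bar> \<le> \<bar>Astar m a (q k) x\<bar>"
proof (cases "\<forall>x\<in>\<Omega>. \<bar>Astar m a (q k) x\<bar> \<le> 1")
  case False
  then obtain y where y: "y \<in> \<Omega>" "1 < \<bar>Astar m a (q k) y\<bar>" by force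
  have "Astar m a (q k) y \<noteq> 0" using y by auto
  then obtain x where x: "x \<in> \<Omega>" "\<And>z. z \<in> \<Omega> \<Longrightarrow> \<bar>Astar m a (q k) z\<bar> \<le> \<bar>Astar m a (q k) x\<bar>"
    using c0_on_attains_max[of \<Omega> "Astar m a (q k)", OF _ y(1)] c0_on_Astar[of m \<Omega> a "q k"] c0 by blast
  have "x \<in> X k" unfolding exch_X_def locmax_abs_def
    using x y(2) x(2)[OF y(1)] by (auto intro!: exI[of _ 1])
  then show ?thesis using x maximizer by blast
qed (use feasible in blast)

lemma gap_tendsto_0:
  assumes lip: "mlipschitz_grad m g L" and L: "0 < L"
  shows "gap \<longlonglongrightarrow> 0"
proof -
  obtain w T where T: "0 \<le> T"
    "\<And>k M. 0 \<le> M \<Longrightarrow> (\<And>x. x \<in> \<Omega> \<Longrightarrow> \<bar>Astar m a (q k) x\<bar> \<le> M) \<Longrightarrow> gap k \<le> T * (M - 1)"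
    using dual_certificate by metis
  obtain K where K: "K > 0" "\<And>p x. x \<in> \<Omega> \<Longrightarrow> \<bar>Astar m a p x\<bar> \<le> K * nrm m p"
    using Astar_le_nrm by blast
  have le: "gap k \<le> T * K * nrm m (vsub (q (Suc k)) (q k))" for k
  proof (cases k rule: maximizer_or_feasible)
    case feasible
    then have "gap k \<le> T * (1 - 1)" by (intro T(2)) auto
    also have "\<dots> \<le> T * K * nrm m (vsub (q (Suc k)) (q k))" using T(1) K(1) by simp
    finally show ?thesis .
  next
    case (maximizer x)
    \<comment> \<open>The maximiser is a constraint point at step \<open>Suc k\<close>, so the
      excess over 1 can be removed only by moving the dual iterate.\<close>
    have x: "x \<in> \<Omega>" "x \<in> Om (Suc k)" using maximizer exch_X_D X_subset_Om[of k "Suc k"] by auto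
    have "\<bar>Astar m a (vsub (q (Suc k)) (q k)) x\<bar> \<le> K * nrm m (vsub (q (Suc k)) (q k))"
      by (rule K(2)[OF x(1)])
    then have "\<bar>Astar m a (q k) x\<bar> - 1 \<le> K * nrm m (vsub (q (Suc k)) (q k))"
      using Astar_q_le_1[OF x(2)] unfolding Astar_vsub by linarith
    then have "T * (\<bar>Astar m a (q k) x\<bar> - 1) \<le> T * (K * nrm m (vsub (q (Suc k)) (q k)))"
      using T(1) by (rule mult_left_mono)
    moreover have "gap k \<le> T * (\<bar>Astar m a (q k) x\<bar> - 1)" using maximizer by (intro T(2)) auto
    ultimately show ?thesis by simp
  qed
  define c where "c = (T * K)\<^sup>2 * (8 * L)"
  have sq: "(gap k)\<^sup>2 \<le> c * (gap k - gap (Suc k))" for k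
  proof -
    have "(gap k)\<^sup>2 \<le> (T * K * nrm m (vsub (q (Suc k)) (q k)))\<^sup>2"
      by (intro power_mono le gap_nonneg)
    also have "\<dots> = (T * K)\<^sup>2 * (nrm m (vsub (q (Suc k)) (q k)))\<^sup>2" by (simp add: power_mult_distrib)
    also have "\<dots> \<le> (T * K)\<^sup>2 * (8 * L * (gap k - gap (Suc k)))"
      by (intro mult_left_mono nrm_sq_le_gap_diff[OF lip L]) simp
    finally show ?thesis by (simp add: c_def)
  qed
  \<comment> \<open>A monotone bounded sequence converges, so its decrements, and with them the
    squared gaps, tend to 0.\<close>
  have "decseq gap" using gap_mono by (simp add: decseq_def)
  then obtain l where l: "gap \<longlonglongrightarrow> l" using gap_nonneg decseq_convergent[of gap 0] by blast
  have "(\<lambda>k. c * (gap k - gap (Suc k))) \<longlonglongrightarrow> c * (l - l)"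
    by (intro tendsto_intros l LIMSEQ_Suc)
  then have lim: "(\<lambda>k. c * (gap k - gap (Suc k))) \<longlonglongrightarrow> 0" by simp
  have "(\<lambda>k. (gap k)\<^sup>2) \<longlonglongrightarrow> 0"
    by (rule tendsto_sandwich[OF _ _ tendsto_const lim]; rule always_eventually; simp add: sq)
  then have "(\<lambda>k. sqrt ((gap k)\<^sup>2)) \<longlonglongrightarrow> sqrt 0" by (rule tendsto_real_sqrt)
  then show ?thesis by (simp add: gap_nonneg)
qed

section \<open>Local geometry near the spikes\<close>

text \<open>Along the segment from the spike to \<open>x\<close>, the signed radial derivative
  starts at 0 and decreases at rate at least \<open>\<gamma> * (norm h)\<^sup>2\<close>;
  Cauchy-Schwarz then bounds the gradient from below.\<close>

lemma grad_qs_lower_bound: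
  assumes x: "x \<in> \<Omega>" and i: "i < s" "dist x (\<xi> i) \<le> \<tau>\<^sub>0"
  shows "\<gamma> * dist x (\<xi> i) \<le> norm (grad qs x)"
proof (cases "x = \<xi> i")
  case False
  define h where "h = x - \<xi> i"
  define c where "c = (\<lambda>t::real. \<xi> i + t *\<^sub>R h)"
  have c\<Omega>: "c t \<in> \<Omega>" if "t \<in> {0..1}" for t
  proof -
    have "c t = (1 - t) *\<^sub>R \<xi> i + t *\<^sub>R x" by (simp add: c_def h_def algebra_simps)
    then show ?thesis using convexD_alt[OF convex_\<Omega> spikes(1)[OF i(1)] x, of t] that by simp
  qed
  have cd: "dist (c t) (\<xi> i) \<le> \<tau>\<^sub>0" if "t \<in> {0..1}" for t
  proof -
    have "dist (c t) (\<xi> i) = \<bar>t\<bar> * norm h" by (simp add: c_def dist_norm)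
    also have "\<dots> \<le> 1 * norm h" using that by (intro mult_right_mono) auto
    finally show ?thesis using i by (simp add: h_def dist_norm)
  qed
  define \<sigma> where "\<sigma> = sgn (Astar m a qs (c 0))"
  \<comment> \<open>The positive lower bound near spikes rules out a sign change, so concavity may
    be used with the single sign \<open>\<sigma>\<close>.\<close>
  have nz: "Astar m a qs (c t) \<noteq> 0" if "t \<in> {0..1}" for t
  proof -
    have "0 < \<gamma> * \<tau>\<^sub>0\<^sup>2 / 2" using pos by simp
    then show ?thesis using near[OF c\<Omega>[OF that] i(1) cd[OF that]] by auto
  qed
  have contA: "continuous_on {0..1} (\<lambda>t. Astar m a qs (c t))"
    by (rule continuous_on_compose2[OF continuous_on_Astar[of qs]])
       (auto simp: c\<Omega>, auto simp: c_def intro!: continuous_intros)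
  have sg: "sgn (Astar m a qs (c t)) = \<sigma>" if "t \<in> {0..1}" for t
    unfolding \<sigma>_def
    by (rule sgn_constant_on_connected[OF _ contA nz]) (use that in auto)
  define \<phi> where "\<phi> = (\<lambda>t. \<sigma> * (grad qs (c t) \<bullet> h))"
  have der: "(\<phi> has_real_derivative h \<bullet> (\<sigma> *\<^sub>R blinfun_apply (hess qs (c t)) h)) (at t)"
    if "t \<in> {0..1}" for t
  proof -
    have "(c has_derivative (\<lambda>t. t *\<^sub>R h)) (at t)"
      unfolding c_def by (auto intro!: derivative_eq_intros)
    from has_derivative_compose[OF this grad_derivative[OF c\<Omega>[OF that], of qs]]
    have "((\<lambda>t. grad qs (c t)) has_derivative (\<lambda>u. blinfun_apply (hess qs (c t)) (u *\<^sub>R h))) (at t)" .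
    then have "(\<phi> has_derivative (\<lambda>u. \<sigma> * (blinfun_apply (hess qs (c t)) (u *\<^sub>R h) \<bullet> h))) (at t)"
      unfolding \<phi>_def by (intro has_derivative_mult_right has_derivative_inner_left)
    moreover have "(\<lambda>u. \<sigma> * (blinfun_apply (hess qs (c t)) (u *\<^sub>R h) \<bullet> h))
        = (*) (h \<bullet> (\<sigma> *\<^sub>R blinfun_apply (hess qs (c t)) h))"
      by (auto simp: blinfun.scaleR_right inner_commute)
    ultimately show ?thesis by (simp add: has_field_derivative_def)
  qed
  obtain z where z: "0 < z" "z < 1" "\<phi> 1 - \<phi> 0 = (1 - 0) * (h \<bullet> (\<sigma> *\<^sub>R blinfun_apply (hess qs (c z)) h))"
    using MVT2[of 0 1 \<phi> "\<lambda>t. h \<bullet> (\<sigma> *\<^sub>R blinfun_apply (hess qs (c t)) h)"] der by auto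
  have zz: "z \<in> {0..1}" using z by simp
  have "h \<bullet> (\<sigma> *\<^sub>R blinfun_apply (hess qs (c z)) h) \<le> - \<gamma> * (norm h)\<^sup>2"
    using concave[OF c\<Omega>[OF zz] i(1) cd[OF zz], of h] sg[OF zz] by simp
  \<comment> \<open>The value 1 at a spike is the largest allowed, hence the spike is
    stationary.\<close>
  moreover have "\<phi> 0 = 0"
  proof -
    have "locmax_abs \<Omega> (Astar m a qs) (\<xi> i)"
      unfolding locmax_abs_def using spikes[OF i(1)] Astar_qs_le_1 by (auto intro!: exI[of _ 1])
    then show ?thesis using grad_eq_0_at_locmax spikes(2)[OF i(1)] by (force simp: \<phi>_def c_def)
  qed
  ultimately have "\<phi> 1 \<le> - \<gamma> * (norm h)\<^sup>2" using z by simp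
  moreover have "\<bar>\<phi> 1\<bar> \<le> norm (grad qs x) * norm h"
  proof -
    have "\<bar>\<phi> 1\<bar> \<le> 1 * \<bar>grad qs x \<bullet> h\<bar>"
      unfolding \<phi>_def abs_mult by (intro mult_mono) (auto simp: c_def h_def \<sigma>_def sgn_if)
    also have "\<dots> \<le> norm (grad qs x) * norm h" using Cauchy_Schwarz_ineq2 by simp
    finally show ?thesis .
  qed
  ultimately have "(\<gamma> * norm h) * norm h \<le> norm (grad qs x) * norm h"
    by (simp add: power2_eq_square)
  moreover have "norm h > 0" using False by (simp add: h_def)
  ultimately show ?thesis by (simp add: h_def dist_norm)
qed simp

text \<open>Stationarity of A* q_k at \<open>x\<close> turns the gradient of A* q* there into that
  of the difference, which is small. The hypothesis \<open>small\<close> keeps \<open>x\<close> out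
  of the far region, so that the lower bound for the gradient applies.\<close>

lemma X_near_spikes:
  assumes x: "x \<in> X k" and K: "\<And>p. \<bar>Astar m a p x\<bar> \<le> K * nrm m p"
    and small: "K * nrm m (vsub (q k) qs) < \<gamma> * \<tau>\<^sub>0\<^sup>2 / 2"
  shows "\<exists>i<s. \<gamma> * dist x (\<xi> i) \<le> \<bar>\<kappa>\<^sub>g\<bar> * nrm m (vsub (q k) qs)"
proof -
  note xx = exch_X_D[OF x]
  have "\<bar>Astar m a (q k) x - Astar m a qs x\<bar> \<le> K * nrm m (vsub (q k) qs)"
    using K[of "vsub (q k) qs"] by (simp add: Astar_vsub)
  then have "1 - \<gamma> * \<tau>\<^sub>0\<^sup>2 / 2 < \<bar>Astar m a qs x\<bar>" using xx(2) small by linarith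
  then obtain i where i: "i < s" "dist x (\<xi> i) \<le> \<tau>\<^sub>0" using far[OF xx(1)] by force
  have "grad qs x = - grad (vsub (q k) qs) x"
    using xx(3) by (simp add: vsub_def algebra_simps sum_subtractf)
  then have "norm (grad qs x) = norm (grad (vsub (q k) qs) x)" by simp
  also have "\<dots> \<le> \<kappa>\<^sub>g * nrm m (vsub (q k) qs)"
    by (intro grad_bound vsub_mvec q_mvec xx)
  also have "\<dots> \<le> \<bar>\<kappa>\<^sub>g\<bar> * nrm m (vsub (q k) qs)" by (intro mult_right_mono) auto
  finally show ?thesis using grad_qs_lower_bound[OF xx(1) i] i by (intro exI[of _ i]) linarith
qed

text \<open>The gradient vanishes at \<open>x\<close>, so it is of first order in the distance along
  the segment and the change of value is of second order. The value at \<open>y\<close> is at most 1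
  by feasibility.\<close>

lemma excess_le_dist_sq:
  assumes x: "x \<in> X k" and y: "y \<in> Om k"
  shows "\<bar>Astar m a (q k) x\<bar> - 1 \<le> \<bar>\<kappa>\<^sub>h\<bar> * nrm m (q k) * (dist x y)\<^sup>2"
proof -
  note xx = exch_X_D[OF x]
  have y\<Omega>: "y \<in> \<Omega>" using y Om_subset by blast
  define B where "B = \<bar>\<kappa>\<^sub>h\<bar> * nrm m (q k)"
  have B: "0 \<le> B" by (simp add: B_def)
  have seg: "closed_segment x y \<subseteq> \<Omega>"
    using convex_\<Omega> xx(1) y\<Omega> by (simp add: closed_segment_subset)
  have gB: "norm (grad (q k) z) \<le> B * dist x y" if z: "z \<in> closed_segment x y" for z
  proof -
    have "norm (grad (q k) z - grad (q k) x) \<le> B * norm (z - x)"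
    proof (rule differentiable_bound[OF convex_\<Omega>])
      show "(grad (q k) has_derivative blinfun_apply (hess (q k) u)) (at u within \<Omega>)" if "u \<in> \<Omega>" for u
        by (rule has_derivative_at_withinI[OF grad_derivative[OF that]])
      show "onorm (blinfun_apply (hess (q k) u)) \<le> B" if "u \<in> \<Omega>" for u
      proof -
        have "norm (hess (q k) u) \<le> \<kappa>\<^sub>h * nrm m (q k)" by (rule hess_bound[OF q_mvec(1) that])
        also have "\<dots> \<le> B" unfolding B_def by (intro mult_right_mono) auto
        finally show ?thesis by (simp add: norm_blinfun.rep_eq)
      qed
    qed (use z seg xx in auto)
    also have "\<dots> \<le> B * dist x y"
      using z B by (intro mult_left_mono) (auto simp: dist_norm norm_minus_commute dest: segment_bound(1))
    finally show ?thesis using xx(3) by simp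
  qed
  have "norm (Astar m a (q k) y - Astar m a (q k) x) \<le> (B * dist x y) * norm (y - x)"
  proof (rule differentiable_bound[of "closed_segment x y"])
    show "(Astar m a (q k) has_derivative (\<lambda>h. grad (q k) u \<bullet> h)) (at u within closed_segment x y)"
      if "u \<in> closed_segment x y" for u
      using that seg by (intro has_derivative_at_withinI[OF Astar_derivative]) auto
    show "onorm (\<lambda>h. grad (q k) u \<bullet> h) \<le> B * dist x y" if u: "u \<in> closed_segment x y" for u
    proof (rule onorm_le)
      fix h
      have "norm (grad (q k) u \<bullet> h) \<le> norm (grad (q k) u) * norm h"
        using Cauchy_Schwarz_ineq2 by simp
      also have "\<dots> \<le> B * dist x y * norm h" by (intro mult_right_mono gB[OF u]) simp
      finally show "norm (grad (q k) u \<bullet> h) \<le> B * dist x y * norm h" .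
    qed
  qed auto
  also have "\<dots> = B * (dist x y)\<^sup>2" by (simp add: dist_norm norm_minus_commute power2_eq_square)
  finally show ?thesis using Astar_q_le_1[OF y] by (simp add: B_def)
qed

text \<open>The zero vector is feasible for every constraint set, so each iterate lies in a sublevel
  set of the conjugate, which growth around \<open>qb\<close> bounds. The factor 2 absorbs the
  growth constant 8L against the 2L in R.\<close>

lemma nrm_q_le:
  assumes lip: "mlipschitz_grad m g L" and L: "0 < L" and bb: "mbounded_below m f"
    and qb: "qb \<in> mvec m" "\<And>p. p \<in> mvec m \<Longrightarrow> fstar m f qb \<le> fstar m f p"
  shows "nrm m (q k) \<le> 2 * (sqrt (2 * L * (real_of_ereal (fstar m f (\<lambda>_. 0)) - real_of_ereal (fstar m f qb))) + nrm m qb)"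
proof -
  define z where "z = (\<lambda>_::nat. 0::real)"
  have z: "z \<in> mvec m" by (simp add: z_def mvec_def)
  have lower: "ereal (ip m p z - f z) \<le> fstar m f p" for p
    unfolding fstar_def by (rule SUP_upper[OF z])
  \<comment> \<open>Boundedness below of \<open>f\<close> makes the conjugate finite at 0, and hence
    at its minimiser.\<close>
  obtain b where b: "\<And>y. y \<in> mvec m \<Longrightarrow> b \<le> f y" using bb by (auto simp: mbounded_below_def)
  have "fstar m f z \<le> ereal (- b)"
    unfolding fstar_def using b by (intro SUP_least) (simp add: z_def ip_def)
  then obtain v0 where v0: "fstar m f z = ereal v0" using lower[of z] by (cases "fstar m f z") auto
  have "fstar m f qb \<le> ereal v0" using qb(2)[OF z] v0 by simp
  then obtain vb where vb: "fstar m f qb = ereal vb" using lower[of qb] by (cases "fstar m f qb") auto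
  have "feasD m a (Om k) z" using z by (simp add: feasD_def Astar_def z_def)
  then have le0: "- infP m a \<Omega> f (Om k) \<le> v0"
    using q[of k] fstar_q[of k] v0 by (auto simp: solvesD_def)
  have "(\<lambda>i. (q k i + qb i) / 2) \<in> mvec m" using q_mvec(1)[of k] qb(1) by (simp add: mvec_def)
  then have "(nrm m (vsub (q k) qb))\<^sup>2 \<le> 8 * L * (- infP m a \<Omega> f (Om k) - vb)"
    by (intro fstar_quadratic_growth[OF grad_f lip L q_mvec(1) fstar_q qb(1) vb] qb(2))
  also have "\<dots> \<le> 8 * L * (v0 - vb)" using L le0 by simp
  also have "\<dots> = 4 * (2 * L * (v0 - vb))" by simp
  finally have "nrm m (vsub (q k) qb) \<le> sqrt (4 * (2 * L * (v0 - vb)))" by (rule real_le_rsqrt)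
  also have "\<dots> = 2 * sqrt (2 * L * (v0 - vb))" by (subst real_sqrt_mult) simp
  finally show ?thesis
    using nrm_triangle_sub[of m "q k" qb] nrm_nonneg[of m qb] v0 vb
    unfolding z_def[symmetric] distrib_left by (simp del: nrm_nonneg)
qed

section \<open>The pigeonhole step and the linear rate\<close>

lemma gap_after_pigeonhole:
  fixes F :: "'a set"
  assumes T: "0 \<le> T"
    "\<And>k M. 0 \<le> M \<Longrightarrow> (\<And>x. x \<in> \<Omega> \<Longrightarrow> \<bar>Astar m a (q k) x\<bar> \<le> M) \<Longrightarrow> gap k \<le> T * (M - 1)"
    and A: "\<And>k. \<bar>\<kappa>\<^sub>h\<bar> * nrm m (q k) \<le> A"
    and F: "finite F" "cball 0 1 \<subseteq> (\<Union>y\<in>F. ball y (\<epsilon> / 2))"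
    and \<tau>: "0 < \<tau>" and \<epsilon>: "0 < \<epsilon>"
    and close: "\<And>k x. K \<le> k \<Longrightarrow> x \<in> X k \<Longrightarrow> \<exists>i<s. dist x (\<xi> i) \<le> \<tau>"
    and k: "K + s * card F < k"
  shows "gap k \<le> T * A * (\<epsilon> * \<tau>)\<^sup>2"
proof -
  have A0: "0 \<le> A" using A[of 0] by (rule order_trans[rotated]) simp
  \<comment> \<open>This block has \<open>s * card F + 1\<close> indices, one more than the number
    of cells.\<close>
  define I where "I = {K..K + s * card F}"
  have "\<exists>j\<in>I. gap j \<le> T * A * (\<epsilon> * \<tau>)\<^sup>2"
  proof (cases "\<exists>j\<in>I. \<forall>x\<in>\<Omega>. \<bar>Astar m a (q j) x\<bar> \<le> 1")
    case True
    then obtain j where j: "j \<in> I" "\<And>x. x \<in> \<Omega> \<Longrightarrow> \<bar>Astar m a (q j) x\<bar> \<le> 1" by blast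
    have "gap j \<le> T * (1 - 1)" using j by (intro T(2)) auto
    also have "\<dots> \<le> T * A * (\<epsilon> * \<tau>)\<^sup>2" using T(1) A0 by simp
    finally show ?thesis using j by blast
  next
    case False
    have "\<forall>j\<in>I. \<exists>x. x \<in> X j \<and> (\<forall>z\<in>\<Omega>. \<bar>Astar m a (q j) z\<bar> \<le> \<bar>Astar m a (q j) x\<bar>)"
    proof
      fix j assume "j \<in> I"
      then show "\<exists>x. x \<in> X j \<and> (\<forall>z\<in>\<Omega>. \<bar>Astar m a (q j) z\<bar> \<le> \<bar>Astar m a (q j) x\<bar>)"
        using False by (cases j rule: maximizer_or_feasible) blast+
    qed
    then obtain x where x: "\<And>j. j \<in> I \<Longrightarrow> x j \<in> X j"
      "\<And>j z. j \<in> I \<Longrightarrow> z \<in> \<Omega> \<Longrightarrow> \<bar>Astar m a (q j) z\<bar> \<le> \<bar>Astar m a (q j) (x j)\<bar>"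
      by metis
    \<comment> \<open>The net of the unit ball, scaled by \<open>\<tau>\<close> and moved to each
      spike, gives cells of radius \<open>\<epsilon> * \<tau> / 2\<close>; two points in one cell
      are \<open>\<epsilon> * \<tau>\<close>-close.\<close>
    have "\<forall>j\<in>I. \<exists>c. c \<in> {..<s} \<times> F \<and> dist (x j) (\<xi> (fst c) + \<tau> *\<^sub>R snd c) < \<epsilon> * \<tau> / 2"
    proof
      fix j assume j: "j \<in> I"
      then obtain i where i: "i < s" "dist (x j) (\<xi> i) \<le> \<tau>" using close x(1) by (force simp: I_def)
      define u where "u = (1 / \<tau>) *\<^sub>R (x j - \<xi> i)"
      have "norm u \<le> 1" using i \<tau> by (simp add: u_def dist_norm)
      then obtain y where y: "y \<in> F" "dist y u < \<epsilon> / 2" using F(2) by force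
      have "x j - (\<xi> i + \<tau> *\<^sub>R y) = \<tau> *\<^sub>R (u - y)" using \<tau> by (simp add: u_def algebra_simps)
      then have "dist (x j) (\<xi> i + \<tau> *\<^sub>R y) = \<tau> * dist y u"
        using \<tau> by (simp add: dist_norm norm_minus_commute)
      also have "\<dots> < \<tau> * (\<epsilon> / 2)" using \<tau> y by (intro mult_strict_left_mono) auto
      finally show "\<exists>c. c \<in> {..<s} \<times> F \<and> dist (x j) (\<xi> (fst c) + \<tau> *\<^sub>R snd c) < \<epsilon> * \<tau> / 2"
        using i y by (intro exI[of _ "(i, y)"]) (simp add: mult.commute)
    qed
    then obtain c where c: "\<And>j. j \<in> I \<Longrightarrow> c j \<in> {..<s} \<times> F"
      "\<And>j. j \<in> I \<Longrightarrow> dist (x j) (\<xi> (fst (c j)) + \<tau> *\<^sub>R snd (c j)) < \<epsilon> * \<tau> / 2" by metis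
    have "card (c ` I) \<le> card ({..<s} \<times> F)" using c(1) F(1) by (intro card_mono image_subsetI) auto
    also have "\<dots> < card I" by (simp add: I_def card_cartesian_product)
    finally have "\<not> inj_on c I" by (rule pigeonhole)
    then obtain j l where jl: "j \<in> I" "l \<in> I" "j < l" "c j = c l"
      unfolding inj_on_def by (metis linorder_neqE_nat)
    have "dist (x l) (x j) < \<epsilon> * \<tau>"
      using dist_triangle_half_r[of "\<xi> (fst (c j)) + \<tau> *\<^sub>R snd (c j)" "x l" "\<epsilon> * \<tau>" "x j"]
        c(2)[OF jl(1)] c(2)[OF jl(2)] jl(4) by (simp add: dist_commute)
    then have d: "(dist (x l) (x j))\<^sup>2 \<le> (\<epsilon> * \<tau>)\<^sup>2" by (intro power_mono) auto
    \<comment> \<open>As \<open>j < l\<close>, the point \<open>x j\<close> already belongs to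
      \<open>Om l\<close>.\<close>
    have "\<bar>Astar m a (q l) (x l)\<bar> - 1 \<le> \<bar>\<kappa>\<^sub>h\<bar> * nrm m (q l) * (dist (x l) (x j))\<^sup>2"
      using x(1) jl X_subset_Om by (intro excess_le_dist_sq) auto
    also have "\<dots> \<le> A * (\<epsilon> * \<tau>)\<^sup>2" using A A0 d by (intro mult_mono) auto
    finally have "T * (\<bar>Astar m a (q l) (x l)\<bar> - 1) \<le> T * (A * (\<epsilon> * \<tau>)\<^sup>2)"
      using T(1) by (rule mult_left_mono)
    moreover have "gap l \<le> T * (\<bar>Astar m a (q l) (x l)\<bar> - 1)"
      using x(2) jl by (intro T(2)) auto
    ultimately show ?thesis using jl by (intro bexI[of _ l]) (auto simp: mult.assoc)
  qed
  then obtain j where "j \<in> I" "gap j \<le> T * A * (\<epsilon> * \<tau>)\<^sup>2" by blast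
  then show ?thesis using gap_mono[of j k] k by (simp add: I_def)
qed

text \<open>A gradient that is Lipschitz with a nonpositive constant is Lipschitz with every positive one, so
  the quadratic growth of \<open>f*\<close> is arbitrarily strong.\<close>

lemma exact_of_nonpos_lipschitz:
  assumes lip: "mlipschitz_grad m g L" and L: "L \<le> 0"
  shows "q k = qs" "gap k = 0" "X k = {}"
proof -
  define n where "n = (nrm m (vsub (q k) qs))\<^sup>2"
  have le: "n \<le> 8 * L' * gap k" if "0 < L'" for L'
  proof -
    have "mlipschitz_grad m g L'"
      using lip L that unfolding mlipschitz_grad_def
      by (meson mult_right_mono nrm_nonneg order.trans less_imp_le)
    then show ?thesis unfolding n_def using that by (rule nrm_sq_le_gap)
  qed
  have "n \<le> 0"
  proof (rule ccontr)
    assume "\<not> n \<le> 0"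
    then have n: "n > 0" by simp
    have g1: "gap k + 1 > 0" using gap_nonneg[of k] by linarith
    \<comment> \<open>This constant makes the right-hand side at most n/2; the \<open>+ 1\<close>
      covers a zero gap.\<close>
    have "n \<le> 8 * (n / (16 * (gap k + 1))) * gap k" using n g1 by (intro le) simp
    also have "\<dots> = n / 2 * (gap k / (gap k + 1))" using g1 by (simp add: field_simps)
    also have "\<dots> \<le> n / 2 * 1" using n g1 by (intro mult_left_mono) auto
    finally show False using n by simp
  qed
  then have "nrm m (vsub (q k) qs) = 0" by (simp add: n_def)
  then show qk: "q k = qs" by (rule nrm_eq_0_mvec[OF q_mvec])
  show "gap k = 0" using fstar_q[of k] fstar_qs unfolding qk gap_def by simp
  show "X k = {}" unfolding qk exch_X_def locmax_abs_def using Astar_qs_le_1 by (auto simp: not_less)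
qed

text \<open>Induction on \<open>n\<close>: each block of \<open>s * card F + 1\<close> iterations
  shrinks the tolerance by the factor exp(-1). The first condition on \<open>\<epsilon>\<close>
  after positivity is the contraction; those on \<open>C\<close> cover the start and the loss of one
  factor \<open>exp 1\<close> per step.\<close>

lemma linear_convergence:
  fixes F :: "'a set"
  assumes lip: "mlipschitz_grad m g L" and L: "0 < L"
    and rr: "\<And>w. w \<in> subdiff m (fstar m f) qs \<Longrightarrow> - L * ip m w qs \<le> rr"
    and A: "\<And>k. \<bar>\<kappa>\<^sub>h\<bar> * nrm m (q k) \<le> A"
    and F: "finite F" "cball 0 1 \<subseteq> (\<Union>y\<in>F. ball y (\<epsilon> / 2))"
    and \<epsilon>: "0 < \<epsilon>" "\<bar>\<kappa>\<^sub>g\<bar> * (sqrt (8 * rr * A) * \<epsilon>) \<le> \<gamma> * exp (- 1)"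
    and C: "1 \<le> C" "sqrt (8 * rr * A) * \<epsilon> * exp 1 \<le> C" "rr / L * A * (\<epsilon> * exp 1)\<^sup>2 \<le> C"
  shows "\<exists>K. \<forall>n k. K + (s * card F + 1) * n \<le> k \<longrightarrow>
    (\<forall>x\<in>X k. \<exists>i<s. dist x (\<xi> i) \<le> exp (- real n)) \<and>
    nrm m (vsub (q k) qs) \<le> C * exp (- real n) \<and> gap k \<le> C * (exp (- real n))\<^sup>2"
proof -
  obtain w T where w: "w \<in> subdiff m (fstar m f) qs" "ip m w qs = - T" and T: "0 \<le> T"
    "\<And>k M. 0 \<le> M \<Longrightarrow> (\<And>x. x \<in> \<Omega> \<Longrightarrow> \<bar>Astar m a (q k) x\<bar> \<le> M) \<Longrightarrow> gap k \<le> T * (M - 1)"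
    using dual_certificate by metis
  \<comment> \<open>The total variation of the primal solution is thereby controlled by
    \<open>rr\<close> and \<open>L\<close> alone.\<close>
  have Trr: "T \<le> rr / L" using rr[OF w(1)] w(2) L by (simp add: field_simps)
  have A0: "0 \<le> A" using A[of 0] by (rule order_trans[rotated]) simp
  obtain B where B: "B > 0" "\<And>p x. x \<in> \<Omega> \<Longrightarrow> \<bar>Astar m a p x\<bar> \<le> B * nrm m p"
    using Astar_le_nrm by blast
  define \<delta> where "\<delta> k = nrm m (vsub (q k) qs)" for k
  have \<delta>: "\<delta> k \<le> sqrt (8 * L * gap k)" for k
    unfolding \<delta>_def by (rule real_le_rsqrt[OF nrm_sq_le_gap[OF lip L]])
  have "(\<lambda>k. sqrt (8 * L * gap k)) \<longlonglongrightarrow> sqrt (8 * L * 0)"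
    by (intro tendsto_intros gap_tendsto_0[OF lip L])
  then have lim: "(\<lambda>k. sqrt (8 * L * gap k)) \<longlonglongrightarrow> 0" by simp
  have "\<delta> \<longlonglongrightarrow> 0"
    by (rule tendsto_sandwich[OF _ _ tendsto_const lim]; rule always_eventually)
       (simp_all add: \<delta>, simp add: \<delta>_def)
  \<comment> \<open>The three bounds give, in turn, the base estimate for the dual iterate,
    exclusion of the far region, and distance at most 1 to the spikes.\<close>
  define e where "e = Min {1, \<gamma> * \<tau>\<^sub>0\<^sup>2 / 2 / B, \<gamma> / (\<bar>\<kappa>\<^sub>g\<bar> + 1)}"
  have e: "0 < e" using pos B by (simp add: e_def add_nonneg_pos)
  have "\<forall>\<^sub>F k in sequentially. \<delta> k < e \<and> gap k < 1"
    using order_tendstoD(2)[OF \<open>\<delta> \<longlonglongrightarrow> 0\<close> e] order_tendstoD(2)[OF gap_tendsto_0[OF lip L], of 1]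
    by (auto elim: eventually_elim2)
  then obtain K where K: "\<And>k. K \<le> k \<Longrightarrow> \<delta> k < e" "\<And>k. K \<le> k \<Longrightarrow> gap k < 1"
    by (auto simp: eventually_sequentially)
  have close: "\<exists>i<s. \<gamma> * dist x (\<xi> i) \<le> \<bar>\<kappa>\<^sub>g\<bar> * \<delta> k" if k: "K \<le> k" and x: "x \<in> X k" for k x
    unfolding \<delta>_def
  proof (rule X_near_spikes[OF x])
    show "\<bar>Astar m a p x\<bar> \<le> B * nrm m p" for p using B exch_X_D[OF x] by blast
    have "\<delta> k < \<gamma> * \<tau>\<^sub>0\<^sup>2 / 2 / B" using K(1)[OF k] by (simp add: e_def)
    then have "B * \<delta> k < \<gamma> * \<tau>\<^sub>0\<^sup>2 / 2" using B(1) by (simp add: field_simps)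
    then show "B * nrm m (vsub (q k) qs) < \<gamma> * \<tau>\<^sub>0\<^sup>2 / 2" by (simp add: \<delta>_def)
  qed
  have main: "(\<forall>x\<in>X k. \<exists>i<s. dist x (\<xi> i) \<le> exp (- real n)) \<and>
      \<delta> k \<le> C * exp (- real n) \<and> gap k \<le> C * (exp (- real n))\<^sup>2"
    if "K + (s * card F + 1) * n \<le> k" for n k
    using that
  proof (induction n arbitrary: k)
    case 0
    then have k: "K \<le> k" by simp
    have "\<delta> k \<le> 1" "\<delta> k < \<gamma> / (\<bar>\<kappa>\<^sub>g\<bar> + 1)" using K(1)[OF k] by (simp_all add: e_def)
    then have "\<delta> k * (\<bar>\<kappa>\<^sub>g\<bar> + 1) < \<gamma>" by (simp add: pos_less_divide_eq add_nonneg_pos)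
    moreover have "0 \<le> \<delta> k" by (simp add: \<delta>_def)
    ultimately have \<kappa>\<delta>: "\<bar>\<kappa>\<^sub>g\<bar> * \<delta> k \<le> \<gamma> * 1" by (simp add: algebra_simps)
    have "\<exists>i<s. dist x (\<xi> i) \<le> 1" if x: "x \<in> X k" for x
      using close[OF k x] \<kappa>\<delta> pos by (meson mult_le_cancel_left_pos order.trans)
    then show ?case using \<open>\<delta> k \<le> 1\<close> K(2)[OF k] C(1) by auto
  next
    case (Suc n)
    define \<tau> where "\<tau> = exp (- real n)"
    have \<tau>: "0 < \<tau>" "exp (- real (Suc n)) = \<tau> * exp (- 1)" "\<tau> = exp 1 * (\<tau> * exp (- 1))"
      by (simp_all add: \<tau>_def exp_add[symmetric])
    \<comment> \<open>The one extra iteration per block supplies the strict inequality.\<close>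
    have k: "K + (s * card F + 1) * n + s * card F < k" "K \<le> k" using Suc.prems by auto
    have "gap k \<le> T * A * (\<epsilon> * \<tau>)\<^sup>2"
      by (rule gap_after_pigeonhole[OF T A F \<tau>(1) \<epsilon>(1) _ k(1)]) (use Suc.IH in \<open>auto simp: \<tau>_def\<close>)
    also have "\<dots> \<le> rr / L * A * (\<epsilon> * \<tau>)\<^sup>2"
      by (intro mult_right_mono Trr A0) auto
    finally have gap: "gap k \<le> rr / L * A * (\<epsilon> * \<tau>)\<^sup>2" .
    have "\<delta> k \<le> sqrt (8 * L * gap k)" by (rule \<delta>)
    also have "\<dots> \<le> sqrt (8 * L * (rr / L * A * (\<epsilon> * \<tau>)\<^sup>2))"
      using L gap by (intro real_sqrt_le_mono mult_left_mono) auto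
    \<comment> \<open>\<open>L\<close> cancels between the growth constant and the bound on the
      total variation.\<close>
    also have "8 * L * (rr / L * A * (\<epsilon> * \<tau>)\<^sup>2) = (8 * rr * A) * (\<epsilon> * \<tau>)\<^sup>2" using L by simp
    also have "sqrt \<dots> = sqrt (8 * rr * A) * (\<epsilon> * \<tau>)"
      using \<epsilon>(1) \<tau>(1) by (subst real_sqrt_mult) simp
    finally have \<delta>k: "\<delta> k \<le> sqrt (8 * rr * A) * (\<epsilon> * \<tau>)" .
    have "\<bar>\<kappa>\<^sub>g\<bar> * \<delta> k \<le> \<bar>\<kappa>\<^sub>g\<bar> * (sqrt (8 * rr * A) * (\<epsilon> * \<tau>))" by (intro mult_left_mono \<delta>k) simp
    also have "\<dots> = \<bar>\<kappa>\<^sub>g\<bar> * (sqrt (8 * rr * A) * \<epsilon>) * \<tau>" by simp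
    also have "\<dots> \<le> \<gamma> * exp (- 1) * \<tau>" using \<epsilon>(2) \<tau>(1) by (intro mult_right_mono) auto
    finally have \<kappa>\<delta>: "\<bar>\<kappa>\<^sub>g\<bar> * \<delta> k \<le> \<gamma> * (\<tau> * exp (- 1))" by (simp add: mult_ac)
    have "\<exists>i<s. dist x (\<xi> i) \<le> \<tau> * exp (- 1)" if x: "x \<in> X k" for x
      using close[OF k(2) x] \<kappa>\<delta> pos by (meson mult_le_cancel_left_pos order.trans)
    moreover have "\<delta> k \<le> C * (\<tau> * exp (- 1))"
    proof -
      have "\<delta> k \<le> sqrt (8 * rr * A) * (\<epsilon> * (exp 1 * (\<tau> * exp (- 1))))" unfolding \<tau>(3)[symmetric] by (rule \<delta>k)
      also have "\<dots> = (sqrt (8 * rr * A) * \<epsilon> * exp 1) * (\<tau> * exp (- 1))" by (simp only: mult_ac)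
      also have "\<dots> \<le> C * (\<tau> * exp (- 1))" using \<tau>(1) by (intro mult_right_mono C) auto
      finally show ?thesis .
    qed
    moreover have "gap k \<le> C * (\<tau> * exp (- 1))\<^sup>2"
    proof -
      have "gap k \<le> rr / L * A * (\<epsilon> * (exp 1 * (\<tau> * exp (- 1))))\<^sup>2" unfolding \<tau>(3)[symmetric] by (rule gap)
      also have "\<dots> = (rr / L * A * (\<epsilon> * exp 1)\<^sup>2) * (\<tau> * exp (- 1))\<^sup>2"
        by (simp only: power_mult_distrib mult_ac)
      also have "\<dots> \<le> C * (\<tau> * exp (- 1))\<^sup>2" by (intro mult_right_mono C) auto
      finally show ?thesis .
    qed
    ultimately show ?case unfolding \<tau>(2) by blast
  qed
  then show ?thesis unfolding \<delta>_def by blast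
qed

end

section \<open>Choice of uniform constants and conclusion\<close>

lemma hdist_le:
  assumes "0 \<le> \<tau>" "\<And>z. z \<in> Z \<Longrightarrow> \<exists>y\<in>Y. dist z y \<le> \<tau>"
  shows "hdist Y Z \<le> ereal \<tau>"
proof (cases "Z = {}")
  case False
  have "(INF y\<in>Y. ereal (dist y z)) \<le> ereal \<tau>" if z: "z \<in> Z" for z
  proof -
    obtain y where "y \<in> Y" "dist z y \<le> \<tau>" using assms(2)[OF z] by blast
    then show ?thesis by (intro INF_lower2[of y]) (auto simp: dist_commute)
  qed
  then show ?thesis using False by (auto simp: hdist_def intro: SUP_least)
qed (use assms in \<open>simp add: hdist_def\<close>)

text \<open>Quantifying the scalar parameters before the constants, and all problem data after them,
  expresses what the constants may depend on; the dimension enters through the type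
  \<open>'a\<close>.\<close>

theorem mainTheorem11:
  shows "\<forall>(s::nat) (\<gamma>::real) (\<tau>\<^sub>0::real) (\<kappa>::real) (\<kappa>\<^sub>g::real) (\<kappa>\<^sub>h::real) (\<rho>::real) (R::real) (L::real).
    \<exists>\<tau>b C C'::real. 0 < \<tau>b \<and> 0 < C \<and> 0 < C' \<and>
    (\<forall>(\<Omega>::'a::euclidean_space set) (m::nat) (a::nat \<Rightarrow> 'a \<Rightarrow> real) (Da::nat \<Rightarrow> 'a \<Rightarrow> 'a)
       (H::nat \<Rightarrow> 'a \<Rightarrow> 'a \<Rightarrow>\<^sub>L 'a) (f::(nat \<Rightarrow> real) \<Rightarrow> real) (g::(nat \<Rightarrow> real) \<Rightarrow> (nat \<Rightarrow> real))
       (\<alpha>::nat \<Rightarrow> real) (\<xi>::nat \<Rightarrow> 'a) (qs::nat \<Rightarrow> real) (qb::nat \<Rightarrow> real) (rr::real)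
       (Om::nat \<Rightarrow> 'a set) (q::nat \<Rightarrow> nat \<Rightarrow> real).
      \<comment> \<open>Omega nonempty open convex\<close>
      open \<Omega> \<and> convex \<Omega> \<and> \<Omega> \<noteq> {} \<and>
      \<comment> \<open>a_i in C_0(Omega) and C^2(Omega), with uniformly bounded first and second derivatives\<close>
      (\<forall>i<m. c0_on \<Omega> (a i) \<and> continuous_on \<Omega> (H i) \<and>
         (\<forall>x\<in>\<Omega>. (a i has_derivative (\<lambda>h. Da i x \<bullet> h)) (at x) \<and>
                 (Da i has_derivative blinfun_apply (H i x)) (at x))) \<and>
      (\<exists>B. \<forall>i<m. \<forall>x\<in>\<Omega>. norm (Da i x) \<le> B \<and> norm (H i x) \<le> B) \<and>
      \<comment> \<open>f convex, bounded below, differentiable with L-Lipschitz gradient g\<close>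
      mconvex m f \<and> mbounded_below m f \<and> mgrad m f g \<and> mlipschitz_grad m g L \<and>
      \<comment> \<open>source condition\<close>
      inj_on \<xi> {..<s} \<and> (\<forall>i<s. \<xi> i \<in> \<Omega> \<and> \<alpha> i \<noteq> 0) \<and>
      (\<forall>\<nu>. solvesP m a \<Omega> f \<Omega> \<nu> \<longleftrightarrow> spike_pair s \<alpha> \<xi> \<nu>) \<and>
      solvesD m a f \<Omega> qs \<and>
      (\<forall>x\<in>\<Omega>. \<bar>Astar m a qs x\<bar> = 1 \<longleftrightarrow> (\<exists>i<s. x = \<xi> i)) \<and>
      0 < \<tau>\<^sub>0 \<and> 0 < \<gamma> \<and>
      (\<forall>x\<in>\<Omega>. (\<exists>i<s. dist x (\<xi> i) \<le> \<tau>\<^sub>0) \<longrightarrow>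
          \<gamma> * \<tau>\<^sub>0\<^sup>2 / 2 \<le> \<bar>Astar m a qs x\<bar> \<and>
          (\<forall>h. h \<bullet> (sgn (Astar m a qs x) *\<^sub>R blinfun_apply (\<Sum>i<m. qs i *\<^sub>R H i x) h)
                 \<le> - \<gamma> * (norm h)\<^sup>2)) \<and>
      (\<forall>x\<in>\<Omega>. (\<forall>i<s. \<tau>\<^sub>0 \<le> dist x (\<xi> i)) \<longrightarrow> \<bar>Astar m a qs x\<bar> \<le> 1 - \<gamma> * \<tau>\<^sub>0\<^sup>2 / 2) \<and>
      \<comment> \<open>the constants kappa, kappa_nabla, kappa_hess, R, rho\<close>
      \<kappa> = Sup {\<bar>Astar m a p x\<bar> | p x. p \<in> mvec m \<and> nrm m p \<le> 1 \<and> x \<in> \<Omega>} \<and>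
      \<kappa>\<^sub>g = Sup {norm (\<Sum>i<m. p i *\<^sub>R Da i x) | p x. p \<in> mvec m \<and> nrm m p \<le> 1 \<and> x \<in> \<Omega>} \<and>
      \<kappa>\<^sub>h = Sup {norm (\<Sum>i<m. p i *\<^sub>R H i x) | p x. p \<in> mvec m \<and> nrm m p \<le> 1 \<and> x \<in> \<Omega>} \<and>
      qb \<in> mvec m \<and> (\<forall>p\<in>mvec m. fstar m f qb \<le> fstar m f p) \<and>
      R = sqrt (2 * L * (real_of_ereal (fstar m f (\<lambda>_. 0)) - real_of_ereal (fstar m f qb))) + nrm m qb \<and>
      Sup {ereal (- L * ip m w qs) | w. w \<in> subdiff m (fstar m f) qs} = ereal rr \<and> \<rho> = sqrt rr \<and>
      \<comment> \<open>standing assumption and the exchange algorithm\<close>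
      well_posed m a \<Omega> f \<Omega> \<and>
      Om 0 \<subseteq> \<Omega> \<and>
      (\<forall>k. well_posed m a \<Omega> f (Om k) \<and> solvesD m a f (Om k) (q k) \<and>
           Om (Suc k) = Om k \<union> exch_X m a \<Omega> (q k))
      \<longrightarrow>
      (\<exists>k\<^sub>0::nat. \<forall>\<tau>. 0 < \<tau> \<and> \<tau> \<le> \<tau>b \<longrightarrow>
         (let k\<^sub>\<tau> = C * real_of_int \<lceil>ln (\<tau>b / \<tau>)\<rceil> in
           (\<forall>k. real k\<^sub>0 + k\<^sub>\<tau> \<le> real k \<longrightarrow> hdist (\<xi> ` {..<s}) (exch_X m a \<Omega> (q k)) \<le> ereal \<tau>) \<and>
           (\<forall>k. real k\<^sub>0 + k\<^sub>\<tau> + 1 \<le> real k \<longrightarrow>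
               nrm m (vsub (q k) qs) \<le> C' * \<tau> \<and>
               infP m a \<Omega> f (Om k) \<le> infP m a \<Omega> f \<Omega> + C' * \<tau>\<^sup>2))))"
proof (intro allI, goal_cases)
  case (1 s \<gamma> \<tau>\<^sub>0 \<kappa> \<kappa>\<^sub>g \<kappa>\<^sub>h \<rho> R L)
  \<comment> \<open>The data are not yet fixed, so \<open>\<rho>\<^sup>2\<close> stands in for
    \<open>rr\<close> and signs are unknown: this is why \<open>\<epsilon>\<close> has a default
    value and \<open>D\<close>, possibly the root of a negative number, appears in absolute
    value.\<close>
  define A where "A = \<bar>\<kappa>\<^sub>h\<bar> * (2 * R)"
  define D where "D = sqrt (8 * \<rho>\<^sup>2 * A)"
  define \<epsilon> where "\<epsilon> = (if 0 < \<gamma> then \<gamma> * exp (- 1) / (\<bar>\<kappa>\<^sub>g\<bar> * \<bar>D\<bar> + 1) else 1)"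
  have den: "0 < \<bar>\<kappa>\<^sub>g\<bar> * \<bar>D\<bar> + 1" by (intro add_nonneg_pos) auto
  have \<epsilon>: "0 < \<epsilon>" using den by (simp add: \<epsilon>_def)
  \<comment> \<open>The net is chosen before the problem data, so its cardinality is uniform over
    them.\<close>
  obtain F :: "'a set" where F: "finite F" "cball 0 1 \<subseteq> (\<Union>y\<in>F. ball y (\<epsilon> / 2))"
    using compact_cball[of "0::'a" 1] \<epsilon> unfolding compact_eq_totally_bounded by (meson half_gt_zero)
  define N where "N = s * card F + 1"
  define C where "C = 1 + \<bar>D * \<epsilon> * exp 1\<bar> + \<bar>\<rho>\<^sup>2 / L * A * (\<epsilon> * exp 1)\<^sup>2\<bar>"
  show ?case
  proof (rule exI[of _ 1], rule exI[of _ "real N"], rule exI[of _ C], 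
      (intro conjI allI impI; (elim conjE)?), goal_cases)
    case 1 show ?case by simp
  next
    case 2 show ?case unfolding of_nat_0_less_iff N_def by simp
  next
    case 3 show ?case unfolding C_def by linarith
  next
    case (4 \<Omega> m a Da H f g \<alpha> \<xi> qs qb rr Om q)
    note hyp = 4
    obtain B where B: "\<And>i x. i < m \<Longrightarrow> x \<in> \<Omega> \<Longrightarrow> norm (Da i x) \<le> B"
      "\<And>i x. i < m \<Longrightarrow> x \<in> \<Omega> \<Longrightarrow> norm (H i x) \<le> B" using hyp(5) by blast
    interpret exchange_setting \<Omega> m a Da H f g s \<xi> qs Om q \<gamma> \<tau>\<^sub>0 \<kappa>\<^sub>g \<kappa>\<^sub>h
    proof (unfold_locales, goal_cases)
      case 6 then show ?case unfolding hyp(20) by (intro norm_sum_le_Sup_unit[OF B(1)])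
    next
      case 7 then show ?case unfolding hyp(21) by (intro norm_sum_le_Sup_unit[OF B(2)])
    next
      case (15 x i h) then show ?case using hyp(17) by blast
    qed (use hyp in blast)+
    have key: "\<exists>K. \<forall>n k. K + N * n \<le> k \<longrightarrow>
      (\<forall>x\<in>X k. \<exists>i<s. dist x (\<xi> i) \<le> exp (- real n)) \<and>
      nrm m (vsub (q k) qs) \<le> C * exp (- real n) \<and> gap k \<le> C * (exp (- real n))\<^sup>2"
    proof (cases "0 < L")
      case True
      have rr: "- L * ip m w qs \<le> rr" if "w \<in> subdiff m (fstar m f) qs" for w
      proof -
        have "ereal (- L * ip m w qs) \<le> ereal rr"
          unfolding hyp(25)[symmetric] using that by (intro Sup_upper) blast
        then show ?thesis by simp
      qed
      \<comment> \<open>A subgradient with nonpositive pairing shows \<open>rr\<close> to be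
        nonnegative, so squaring \<open>\<rho>\<close> recovers it.\<close>
      obtain w T where "w \<in> subdiff m (fstar m f) qs" "ip m w qs = - T" "0 \<le> T"
        using dual_certificate by metis
      then have "0 \<le> rr" using rr[of w] True by (smt (verit) mult_minus_left
          mult_minus_right mult_nonneg_nonneg)
      then have \<rho>: "\<rho>\<^sup>2 = rr" using hyp(26) by simp
      have A: "\<bar>\<kappa>\<^sub>h\<bar> * nrm m (q k) \<le> A" for k
        unfolding A_def hyp(24) using hyp(23)
        by (intro mult_left_mono nrm_q_le[OF hyp(9) True hyp(7,22)]) auto
      have "\<bar>\<kappa>\<^sub>g\<bar> * (D * \<epsilon>) \<le> (\<bar>\<kappa>\<^sub>g\<bar> * \<bar>D\<bar> + 1) * \<epsilon>"
      proof -
        have "\<bar>\<kappa>\<^sub>g\<bar> * (D * \<epsilon>) \<le> \<bar>\<kappa>\<^sub>g\<bar> * (\<bar>D\<bar> * \<epsilon>)"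
          using \<epsilon> by (intro mult_left_mono mult_right_mono) auto
        also have "\<dots> \<le> (\<bar>\<kappa>\<^sub>g\<bar> * \<bar>D\<bar> + 1) * \<epsilon>" using \<epsilon> by (simp add: distrib_right)
        finally show ?thesis .
      qed
      also have "\<dots> = \<gamma> * exp (- 1)" using den hyp(16) by (simp add: \<epsilon>_def)
      finally have D\<epsilon>: "\<bar>\<kappa>\<^sub>g\<bar> * (D * \<epsilon>) \<le> \<gamma> * exp (- 1)" .
      have aux: "1 \<le> 1 + \<bar>u\<bar> + \<bar>v\<bar>" "u \<le> 1 + \<bar>u\<bar> + \<bar>v\<bar>" "v \<le> 1 + \<bar>u\<bar> + \<bar>v\<bar>"
        for u v :: real by linarith+
      have Cs: "1 \<le> C" "D * \<epsilon> * exp 1 \<le> C" "\<rho>\<^sup>2 / L * A * (\<epsilon> * exp 1)\<^sup>2 \<le> C"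
        unfolding C_def by (rule aux)+
      show ?thesis unfolding N_def
        by (rule linear_convergence[OF hyp(9) True rr A F \<epsilon>
          D\<epsilon>[unfolded D_def \<rho>] Cs(1)
          Cs(2)[unfolded D_def \<rho>] Cs(3)[unfolded \<rho>]])
    next
      case False
      have "0 \<le> C" unfolding C_def by linarith
      moreover have "nrm m (vsub qs qs) = 0" by (simp add: vsub_def nrm_def ip_def)
      ultimately show ?thesis
        using exact_of_nonpos_lipschitz[OF hyp(9)] False by (intro exI[of _ 0]) auto
    qed
    then obtain K where K: "\<And>n k. K + N * n \<le> k \<Longrightarrow>
      (\<forall>x\<in>X k. \<exists>i<s. dist x (\<xi> i) \<le> exp (- real n)) \<and>
      nrm m (vsub (q k) qs) \<le> C * exp (- real n) \<and> gap k \<le> C * (exp (- real n))\<^sup>2" by blast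
    have "0 \<le> C" unfolding C_def by linarith
    show ?case
    proof (intro exI[of _ K] allI impI)
      fix \<tau> :: real assume \<tau>: "0 < \<tau> \<and> \<tau> \<le> 1"
      \<comment> \<open>As \<open>\<tau>\<close> is at most 1, the ceiling is nonnegative and
        \<open>n\<close> is the number of blocks that brings the tolerance below
        \<open>\<tau>\<close>.\<close>
      define n where "n = nat \<lceil>ln (1 / \<tau>)\<rceil>"
      have "0 \<le> ln (1 / \<tau>)" using \<tau> by simp
      then have n: "real_of_int \<lceil>ln (1 / \<tau>)\<rceil> = real n" by (simp add: n_def)
      have "ln (1 / \<tau>) \<le> real n" unfolding n[symmetric] by (rule le_of_int_ceiling)
      then have "- real n \<le> ln \<tau>" using \<tau> by (simp add: ln_div)
      then have \<tau>n: "exp (- real n) \<le> \<tau>" using \<tau> by (metis exp_le_cancel_iff exp_ln)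
      have kn: "K + N * n \<le> k" if "real K + real N * real n \<le> real k" for k
        using that by (metis of_nat_add of_nat_le_iff of_nat_mult)
      have "hdist (\<xi> ` {..<s}) (X k) \<le> ereal \<tau>" if k: "real K + real N * real n \<le> real k" for k
      proof (rule hdist_le)
        fix x assume "x \<in> X k"
        then obtain i where "i < s" "dist x (\<xi> i) \<le> exp (- real n)" using K[OF kn[OF k]] by blast
        then show "\<exists>y\<in>\<xi> ` {..<s}. dist x y \<le> \<tau>" using \<tau>n by (intro bexI[of _ "\<xi> i"]) auto
      qed (use \<tau> in simp)
      moreover have "nrm m (vsub (q k) qs) \<le> C * \<tau> \<and>
          infP m a \<Omega> f (Om k) \<le> infP m a \<Omega> f \<Omega> + C * \<tau>\<^sup>2"
        if k: "real K + real N * real n + 1 \<le> real k" for k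
      proof -
        have "C * exp (- real n) \<le> C * \<tau>" "C * (exp (- real n))\<^sup>2 \<le> C * \<tau>\<^sup>2"
          using \<open>0 \<le> C\<close> \<tau>n by (intro mult_left_mono power_mono; simp)+
        then show ?thesis using K[OF kn, of k] k unfolding gap_def by linarith
      qed
      ultimately show "let k\<^sub>\<tau> = real N * real_of_int \<lceil>ln (1 / \<tau>)\<rceil> in
           (\<forall>k. real K + k\<^sub>\<tau> \<le> real k \<longrightarrow> hdist (\<xi> ` {..<s}) (X k) \<le> ereal \<tau>) \<and>
           (\<forall>k. real K + k\<^sub>\<tau> + 1 \<le> real k \<longrightarrow>
               nrm m (vsub (q k) qs) \<le> C * \<tau> \<and>
               infP m a \<Omega> f (Om k) \<le> infP m a \<Omega> f \<Omega> + C * \<tau>\<^sup>2)"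
        unfolding Let_def n by blast
    qed
  qed
qed

end
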